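(* Let $2\le m\le n$ and let $A$ be an $m\times n$ array whose entries are independent uniform random real numbers in $[0,1)$. The expected effective entropy of 4-sided range maximum queries on $A$ (query ranges $[i_1\cdots i_2]\times[j_1\cdots j_2]$, over all $1\le i_1\le i_2\le m$, $1\le j_1\le j_2\le n$) is $\Theta(nm)$ bits, and the expected effective entropy of 3-sided range maximum queries on $A$ (query ranges $[1\cdots i]\times[j_1\cdots j_2]$, over all $1\le i\le m$, $1\le j_1\le j_2\le n$) is $\Theta(n(\log m)^2)$ bits.
   Context: All logarithms are to base 2. Positions are given as (row, column), with rows $1,\dots,m$ and columns $1,\dots,n$. For a query range $q$, the answer is $\mathrm{RMQ}(A,q)=\mathrm{argmax}_{(i,j)\in q}A[i,j]$. Two arrays are equivalent with respect to a set of queries if they give the same answers to all queries in the set. An encoding maps arrays of known dimensions to bit strings so that all queries in the set can be answered from the bit string alone, without access to the array. The expected effective entropy, for a random array, is the minimum over all uniquely decodable encodings of the expected number of bits used; up to an additive constant it is the Shannon entropy of the random equivalence class of the array. *)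

theory Defs
  imports "HOL-Probability.Probability"
begin

definition positions :: "nat \<Rightarrow> nat \<Rightarrow> (nat \<times> nat) set" where
  "positions m n = {1..m} \<times> {1..n}"

definition arrays :: "nat \<Rightarrow> nat \<Rightarrow> (nat \<times> nat \<Rightarrow> real) set" where
  "arrays m n = positions m n \<rightarrow>\<^sub>E UNIV"

definition random_array :: "nat \<Rightarrow> nat \<Rightarrow> (nat \<times> nat \<Rightarrow> real) measure" where
  "random_array m n = (\<Pi>\<^sub>M p\<in>positions m n. uniform_measure lborel {0..<1})"

lemma space_random_array: "space (random_array m n) = arrays m n"
  by (simp add: random_array_def arrays_def space_PiM)

lemma prob_space_random_array: "prob_space (random_array m n)"
  unfolding random_array_def
  by (intro prob_space_PiM prob_space_uniform_measure) simp_all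

text \<open>
  Ties are broken by the choice operator inside \<^const>\<open>arg_max_on\<close>: the answer is a fixed function of
  the set of maximal positions in the range, so it is well defined for every array. Ties have
  probability zero under the random array.
\<close>
definition RMQ :: "(nat \<times> nat \<Rightarrow> real) \<Rightarrow> (nat \<times> nat) set \<Rightarrow> nat \<times> nat" where
  "RMQ A q = arg_max_on A q"

definition four_sided :: "nat \<Rightarrow> nat \<Rightarrow> (nat \<times> nat) set set" where
  "four_sided m n = {{i1..i2} \<times> {j1..j2} | i1 i2 j1 j2.
     1 \<le> i1 \<and> i1 \<le> i2 \<and> i2 \<le> m \<and> 1 \<le> j1 \<and> j1 \<le> j2 \<and> j2 \<le> n}"

definition three_sided :: "nat \<Rightarrow> nat \<Rightarrow> (nat \<times> nat) set set" where
  "three_sided m n = {{1..i} \<times> {j1..j2} | i j1 j2.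
     1 \<le> i \<and> i \<le> m \<and> 1 \<le> j1 \<and> j1 \<le> j2 \<and> j2 \<le> n}"

definition uniquely_decodable :: "bool list set \<Rightarrow> bool" where
  "uniquely_decodable C \<longleftrightarrow> inj_on concat (lists C)"

text \<open>
  The decoder sees the bit string and the query, but not the array; it may depend on the
  dimensions and on the set of queries. An encoding has to be correct on every array, and it must
  be measurable for its expected length to make sense.
\<close>
definition encodings ::
  "nat \<Rightarrow> nat \<Rightarrow> (nat \<times> nat) set set \<Rightarrow> ((nat \<times> nat \<Rightarrow> real) \<Rightarrow> bool list) set" where
  "encodings m n Q = {enc.
     enc \<in> random_array m n \<rightarrow>\<^sub>M count_space UNIV \<and>
     uniquely_decodable (enc ` arrays m n) \<and>
     (\<exists>dec. \<forall>A\<in>arrays m n. \<forall>q\<in>Q. dec (enc A) q = RMQ A q)}"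

definition expected_bits ::
  "nat \<Rightarrow> nat \<Rightarrow> ((nat \<times> nat \<Rightarrow> real) \<Rightarrow> bool list) \<Rightarrow> ennreal" where
  "expected_bits m n enc = (\<integral>\<^sup>+ A. of_nat (length (enc A)) \<partial>random_array m n)"

definition expected_effective_entropy :: "nat \<Rightarrow> nat \<Rightarrow> (nat \<times> nat) set set \<Rightarrow> ennreal" where
  "expected_effective_entropy m n Q = (INF enc\<in>encodings m n Q. expected_bits m n enc)"

end

(*
By the Kraft-McMillan inequality the expected effective entropy is at least the entropy of any random
variable that the answers determine, and by its converse at most the expected code length given by any
product of Bernoulli distributions on a family of events that determines the answers.

Lower bounds: whether an entry is a record, i.e. larger than the k - 1 entries preceding it in a chain,
is decided by one query if the chain up to this entry is a query range; for disjoint chains of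
independent uniform entries these events are independent with probabilities 1/k, and each has entropy
at least (log k)/k. Chains of two adjacent entries in a row give a lower bound of order n m, and the
columns give n (sum of (log i)/i), which is of order n (log m)^2.

Upper bounds: an array is encoded by the pairs of positions (x, y) such that y is the only entry larger
than x in the smallest query range containing both. In a range of s entries this has probability
1/(s (s - 1)), hence costs O(log s / s^2) bits, and these costs sum to O(n m) in the 4-sided case. In the
3-sided case only prefix maxima of the columns can be answers, and the sum over the rows is of the
order of n (sum of (log i)/i).
*)
theory Submission
  imports Defs "HOL-Library.Sublist"
begin

section \<open>Kraft inequality and prefix codes\<close>

text \<open>The events of the upper bound are far from independent, but the length of a product code
  is a sum over the events, so linearity of expectation gives its cost whatever their joint law.
  Demanding that \<open>y\<close> be the only larger entry makes an event quadratically rare in the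
  size of the range, which lets the costs of all pairs be summed. The answers still follow: among
  the entries of a query range larger than \<open>x\<close>, one with a smallest range has no other
  larger entry in it, provided that any other candidate inside has a strictly smaller range. For
  3-sided queries two entries of one column can violate this, and the entries above \<open>x\<close>
  in its own column lie in every range that contains \<open>x\<close>; hence a cut column and
  separate events for column records. These records are also the events of the lower bound. Two
  further points shape the proof: an encoding must be correct for arrays with ties too, though they
  form a null set, and it may use infinitely many codewords, so that the lower bound has to pass to
  a finite subcode.\<close>

lemma sum_lists_length_concat:
  fixes F :: "bool list set"
  assumes "finite F"
  shows "(\<Sum>xs | set xs \<subseteq> F \<and> length xs = k. (1/2) ^ length (concat xs)) = (\<Sum>c\<in>F. (1/2::real) ^ length c) ^ k"
proof (induction k)
  case 0
  have "{xs. set xs \<subseteq> F \<and> length xs = 0} = {[]}" by auto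
  then show ?case by simp
next
  case (Suc k)
  have eq: "{xs. set xs \<subseteq> F \<and> length xs = Suc k} = (\<lambda>(c, xs). c # xs) ` (F \<times> {xs. set xs \<subseteq> F \<and> length xs = k})"
    by (auto simp: length_Suc_conv image_iff)
  have inj: "inj_on (\<lambda>(c, xs). c # xs) (F \<times> {xs. set xs \<subseteq> F \<and> length xs = k})"
    by (auto simp: inj_on_def)
  show ?case
    unfolding eq sum.reindex[OF inj]
    by (simp add: case_prod_unfold power_add Suc.IH[symmetric] sum_product sum.cartesian_product)
qed

text \<open>If the sum exceeded 1, its powers would grow exponentially. But the \<open>k\<close>-th
  power is the total weight of the concatenations of \<open>k\<close> codewords, which are pairwise
  distinct by unique decodability and have length at most \<open>k * M\<close>; all words of one
  length weigh 1 together, so the growth is at most linear.\<close>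

lemma kraft_mcmillan:
  fixes F :: "bool list set"
  assumes fin: "finite F" and ud: "uniquely_decodable F"
  shows "(\<Sum>c\<in>F. (1/2::real) ^ length c) \<le> 1"
proof (rule ccontr)
  let ?S = "\<Sum>c\<in>F. (1/2::real) ^ length c"
  assume "\<not> ?S \<le> 1"
  then have S: "?S > 1" by simp
  define M where "M = (\<Sum>c\<in>F. length c)"
  have lenM: "length c \<le> M" if "c \<in> F" for c
    unfolding M_def using member_le_sum[OF that _ fin, of length] by simp
  have bound: "?S ^ k \<le> real (k * M + 1)" for k
  proof -
    let ?X = "{xs. set xs \<subseteq> F \<and> length xs = k}"
    have len: "length (concat xs) \<le> k * M" if "xs \<in> ?X" for xs
    proof -
      have "sum_list (map length xs) \<le> sum_list (map (\<lambda>_. M) xs)"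
        by (rule sum_list_mono) (use that lenM in auto)
      then show ?thesis using that by (simp add: length_concat sum_list_triv)
    qed
    have inj: "inj_on concat ?X"
      using ud unfolding uniquely_decodable_def by (rule inj_on_subset) auto
    have fin2: "finite {ys :: bool list. length ys \<le> k * M}"
      using finite_lists_length_le[of "UNIV :: bool set" "k * M"] by simp
    have "?S ^ k = (\<Sum>ys\<in>concat ` ?X. (1/2) ^ length ys)"
      using sum_lists_length_concat[OF fin, of k] by (simp add: sum.reindex[OF inj])
    also have "\<dots> \<le> (\<Sum>ys | length ys \<le> k * M. (1/2::real) ^ length (ys :: bool list))"
      by (rule sum_mono2[OF fin2]) (use len in auto)
    also have "\<dots> = (\<Sum>l\<le>k * M. \<Sum>ys | length (ys :: bool list) = l. (1/2::real) ^ length ys)"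
    proof -
      have "{ys :: bool list. length ys \<le> k * M} = (\<Union>l\<in>{..k * M}. {ys. length ys = l})" by auto
      moreover have "finite {ys :: bool list. length ys = l}" for l
        using finite_lists_length_eq[of "UNIV :: bool set" l] by simp
      ultimately show ?thesis
        by (simp add: sum.UNION_disjoint disjoint_iff)
    qed
    also have "\<dots> = (\<Sum>l\<le>k * M. 1)"
    proof (rule sum.cong[OF refl])
      fix l
      have "card {ys :: bool list. length ys = l} = 2 ^ l"
        using card_lists_length_eq[of "UNIV :: bool set" l] by simp
      then show "(\<Sum>ys | length (ys :: bool list) = l. (1/2::real) ^ length ys) = 1"
        by (simp add: power_divide)
    qed
    finally show ?thesis by simp
  qed
  have "(\<lambda>k. real (k * M + 1) / ?S ^ k) \<longlonglongrightarrow> 0"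
  proof -
    have 1: "(\<lambda>k. of_nat k / ?S ^ k) \<longlonglongrightarrow> 0"
      using lim_n_over_pown[of ?S] S by simp
    have 2: "(\<lambda>k. 1 / ?S ^ k) \<longlonglongrightarrow> 0"
      using LIMSEQ_inverse_realpow_zero[OF S] by (simp add: inverse_eq_divide)
    have "(\<lambda>k. real M * (of_nat k / ?S ^ k) + 1 / ?S ^ k) \<longlonglongrightarrow> real M * 0 + 0"
      by (intro tendsto_intros 1 2)
    then show ?thesis by (simp add: add_divide_distrib mult.commute add.commute)
  qed
  then have "eventually (\<lambda>k. real (k * M + 1) / ?S ^ k < 1) sequentially"
    by (rule order_tendstoD) simp
  then obtain k where "real (k * M + 1) / ?S ^ k < 1"
    by (auto simp: eventually_sequentially)
  moreover have "?S ^ k > 0" using S by simp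
  ultimately have "real (k * M + 1) < ?S ^ k" by (simp add: field_simps)
  then show False using bound[of k] by simp
qed

text \<open>The leading codewords of two parsings of one string are prefixes of it, hence
  comparable, hence equal. The set consisting of the empty word alone is prefix-free but not
  uniquely decodable, which is why \<open>[]\<close> is excluded.\<close>

lemma uniquely_decodable_prefix_free:
  assumes ne: "[] \<notin> C"
    and pf: "\<And>u v. u \<in> C \<Longrightarrow> v \<in> C \<Longrightarrow> prefix u v \<Longrightarrow> u = v"
  shows "uniquely_decodable C"
  unfolding uniquely_decodable_def
proof (rule inj_onI)
  fix xs ys
  assume "xs \<in> lists C" "ys \<in> lists C" "concat xs = concat ys"
  then show "xs = ys"
  proof (induction xs arbitrary: ys rule: list.induct)
    case Nil
    then show ?case using ne by (cases ys) auto
  next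
    case (Cons x xs)
    have "x \<in> C" using Cons.prems by simp
    with ne have "x \<noteq> []" by auto
    with Cons.prems obtain y ys' where ys: "ys = y # ys'" by (cases ys) auto
    have "prefix x (concat ys)" using Cons.prems(3) by (metis concat.simps(2) prefixI)
    moreover have "prefix y (concat ys)" using ys by simp
    ultimately have "prefix x y \<or> prefix y x" by (rule prefix_same_cases)
    with pf[of x y] pf[of y x] Cons.prems ys have "x = y" by auto
    with Cons ys show ?case by auto
  qed
qed

text \<open>Greedy choice by increasing length: an earlier codeword of length \<open>l s\<close>
  blocks \<open>2 ^ (l x - l s)\<close> of the words of length \<open>l x\<close>, and the Kraft sum
  leaves at least one of them free.\<close>

lemma prefix_code_exists:
  fixes l :: "'a \<Rightarrow> nat"
  assumes "finite S" and "(\<Sum>s\<in>S. (1/2::real) ^ l s) \<le> 1"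
  shows "\<exists>f :: 'a \<Rightarrow> bool list. (\<forall>s\<in>S. length (f s) = l s) \<and>
    (\<forall>s\<in>S. \<forall>t\<in>S. prefix (f s) (f t) \<longrightarrow> s = t)"
  using assms
proof (induction S rule: finite_ranking_induct[where f = l])
  case empty
  then show ?case by simp
next
  case (insert x S)
  have "(\<Sum>s\<in>S. (1/2::real) ^ l s) \<le> (\<Sum>s\<in>insert x S. (1/2::real) ^ l s)"
    by (rule sum_mono2) (use insert in auto)
  with insert obtain f :: "'a \<Rightarrow> bool list" where len: "\<And>s. s \<in> S \<Longrightarrow> length (f s) = l s"
    and pf: "\<And>s t. s \<in> S \<Longrightarrow> t \<in> S \<Longrightarrow> prefix (f s) (f t) \<Longrightarrow> s = t"
    by fastforce
  show ?case
  proof (cases "x \<in> S")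
    case True
    then show ?thesis using len pf by (auto simp: insert_absorb)
  next
    case False
    let ?W = "{w :: bool list. length w = l x}"
    let ?ext = "\<lambda>s. {w. length w = l x \<and> prefix (f s) w}"
    have finW: "finite ?W" and cardW: "card ?W = 2 ^ l x"
      using finite_lists_length_eq[of "UNIV :: bool set" "l x"] card_lists_length_eq[of "UNIV :: bool set" "l x"]
      by simp_all
    have card_ext: "card (?ext s) = 2 ^ (l x - l s)" if "s \<in> S" for s
    proof -
      have "?ext s = (\<lambda>w. f s @ w) ` {w. length w = l x - l s}"
        using len[OF that] insert(2)[OF that] by (auto simp: prefix_def image_iff)
      moreover have "inj_on (\<lambda>w. f s @ w) {w. length w = l x - l s}" by (auto simp: inj_on_def)
      ultimately show ?thesis
        using card_lists_length_eq[of "UNIV :: bool set" "l x - l s"] by (simp add: card_image)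
    qed
    have "real (card (\<Union>s\<in>S. ?ext s)) \<le> (\<Sum>s\<in>S. real (card (?ext s)))"
      using card_UN_le[OF \<open>finite S\<close>, of ?ext] unfolding of_nat_sum[symmetric] of_nat_le_iff .
    also have "\<dots> = (\<Sum>s\<in>S. 2 ^ l x * (1/2) ^ l s)"
    proof (rule sum.cong[OF refl])
      fix s assume s: "s \<in> S"
      have "(2::real) ^ (l x - l s) = 2 ^ l x * (1/2) ^ l s"
        using insert(2)[OF s] by (simp add: power_diff power_divide)
      then show "real (card (?ext s)) = 2 ^ l x * (1/2) ^ l s" by (simp add: card_ext[OF s])
    qed
    also have "\<dots> = 2 ^ l x * (\<Sum>s\<in>S. (1/2) ^ l s)" by (simp add: sum_distrib_left)
    \<comment> \<open>Strict, because the weight of \<open>x\<close> itself is positive and belongs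
      to the same Kraft sum.\<close>
    also have "\<dots> < 2 ^ l x * 1"
    proof (rule mult_strict_left_mono)
      have "(1/2::real) ^ l x > 0" by simp
      then show "(\<Sum>s\<in>S. (1/2::real) ^ l s) < 1" using insert.prems insert(1) False unfolding sum.insert[OF insert(1) False] by linarith
    qed simp
    also have "\<dots> = real (card ?W)" using cardW by simp
    finally have "card (\<Union>s\<in>S. ?ext s) < card ?W" by simp
    then have "\<not> ?W \<subseteq> (\<Union>s\<in>S. ?ext s)"
      using card_mono[of "\<Union>s\<in>S. ?ext s" ?W] insert(1) finite_subset[OF _ finW] by fastforce
    then obtain w where w: "length w = l x" "\<And>s. s \<in> S \<Longrightarrow> \<not> prefix (f s) w" by auto
    have w2: "\<not> prefix w (f s)" if "s \<in> S" for s
    proof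
      assume p: "prefix w (f s)"
      then have "length w \<le> length (f s)" by (rule prefix_length_le)
      then have "length w = length (f s)" using w(1) len[OF that] insert(2)[OF that] by simp
      with p have "w = f s" by (auto simp: prefix_def)
      with w(2)[OF that] show False by simp
    qed
    show ?thesis
      by (rule exI[of _ "f(x := w)"]) (use w w2 len pf False in auto)
  qed
qed

section \<open>Records of independent uniform variables\<close>

abbreviation U01 :: "real measure" where "U01 \<equiv> uniform_measure lborel {0..<1}"

lemma prob_space_U01: "prob_space U01"
  by (rule prob_space_uniform_measure) simp_all

lemma nn_integral_U01:
  assumes [measurable]: "f \<in> borel_measurable borel"
  shows "(\<integral>\<^sup>+ x. f x \<partial>U01) = (\<integral>\<^sup>+ x. f x * indicator {0..<1} x \<partial>lborel)"
  by (subst nn_integral_uniform_measure) (auto simp: divide_ennreal_def)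

text \<open>The integral over the value \<open>x\<close> of a record: \<open>n\<close> predecessors
  lie below it with probability \<open>x ^ n\<close>, and the record itself has to stay below the
  threshold \<open>s\<close>.\<close>

lemma nn_integral_U01_power:
  assumes "0 \<le> s" "s \<le> 1"
  shows "(\<integral>\<^sup>+ x. ennreal (x ^ n) * indicator {..<s} x \<partial>U01) = ennreal (s ^ Suc n / Suc n)"
proof -
  have "(\<integral>\<^sup>+ x. ennreal (x ^ n) * indicator {..<s} x \<partial>U01) =
      (\<integral>\<^sup>+ x. ennreal (x ^ n) * indicator {..<s} x * indicator {0..<1} x \<partial>lborel)"
    by (rule nn_integral_U01) measurable
  also have "\<dots> = (\<integral>\<^sup>+ x. ennreal (x ^ n) * indicator {0..s} x \<partial>lborel)"
  proof (rule nn_integral_cong_AE)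
    show "AE x in lborel. ennreal (x ^ n) * indicator {..<s} x * indicator {0..<1} x = ennreal (x ^ n) * indicator {0..s} x"
      using AE_lborel_singleton[of s] by eventually_elim (use assms in \<open>auto simp: indicator_def\<close>)
  qed
  also have "\<dots> = ennreal (s ^ Suc n / Suc n - 0 ^ Suc n / Suc n)"
  proof (rule nn_integral_FTC_Icc)
    show "((\<lambda>x. x ^ Suc n / Suc n) has_real_derivative x ^ n) (at x)" for x
      by (rule DERIV_cong[OF DERIV_cdivide[OF DERIV_pow]]) simp
  qed (use assms in auto)
  finally show ?thesis by simp
qed

lemma measurable_component_U01:
  "q \<in> I \<Longrightarrow> (\<lambda>A. A q) \<in> borel_measurable (PiM I (\<lambda>_. U01))"
  using measurable_component_singleton[of q I "\<lambda>_. U01"] by (simp cong: measurable_cong_sets)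

text \<open>Chains are encoded as the fibres of \<open>g\<close>, which makes them disjoint by
  construction; \<open>r\<close> gives the order inside a fibre.\<close>

definition preds :: "('i \<Rightarrow> 'g) \<Rightarrow> ('i \<Rightarrow> nat) \<Rightarrow> 'i set \<Rightarrow> 'i \<Rightarrow> 'i set" where
  "preds g r I p = {q \<in> I. g q = g p \<and> r q < r p}"

definition is_record :: "('i \<Rightarrow> 'g) \<Rightarrow> ('i \<Rightarrow> nat) \<Rightarrow> 'i set \<Rightarrow> ('i \<Rightarrow> real) \<Rightarrow> 'i \<Rightarrow> bool" where
  "is_record g r I A p \<longleftrightarrow> (\<forall>q\<in>preds g r I p. A q < A p)"

lemma is_record_sets:
  assumes "finite I" "p \<in> I"
  shows "{A \<in> space (PiM I (\<lambda>_. U01)). is_record g r I A p} \<in> sets (PiM I (\<lambda>_. U01))"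
proof -
  note [measurable] = measurable_component_U01
  have [simp]: "finite (preds g r I p)" using assms by (simp add: preds_def)
  show ?thesis unfolding is_record_def
    by (rule sets.sets_Collect_finite_All) (auto simp: preds_def assms)
qed


lemma records_below_sets:
  assumes "finite I" "T \<subseteq> I"
  shows "{A \<in> space (PiM I (\<lambda>_. U01)). (\<forall>p\<in>I. A p < u p) \<and> (\<forall>p\<in>T. is_record g r I A p)}
    \<in> sets (PiM I (\<lambda>_. U01))" (is "_ \<in> sets ?P")
proof -
  note [measurable] = measurable_component_U01
  have 1: "{A \<in> space ?P. \<forall>p\<in>I. A p < u p} \<in> sets ?P"
    by (rule sets.sets_Collect_finite_All) (use assms in auto)
  have 2: "{A \<in> space ?P. \<forall>p\<in>T. is_record g r I A p} \<in> sets ?P"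
    by (rule sets.sets_Collect_finite_All[OF is_record_sets])
      (use assms finite_subset in auto)
  show ?thesis by (rule sets.sets_Collect_conj[OF 2 1])
qed

text \<open>
  The thresholds \<open>s\<close> are needed for the induction: if the entry of highest rank is a record with value
  \<open>y\<close>, then \<open>y\<close> becomes the threshold of its group.
\<close>
lemma emeasure_records_below:
  fixes r :: "'i \<Rightarrow> nat" and g :: "'i \<Rightarrow> 'g" and s :: "'g \<Rightarrow> real"
  assumes "finite I" "T \<subseteq> I"
    and "\<And>p q. p \<in> T \<Longrightarrow> q \<in> I \<Longrightarrow> q \<noteq> p \<Longrightarrow> g q = g p \<Longrightarrow> r q \<noteq> r p"
    and "\<And>c. 0 \<le> s c" "\<And>c. s c \<le> 1"
  shows "emeasure (PiM I (\<lambda>_. U01))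
      {A \<in> space (PiM I (\<lambda>_. U01)). (\<forall>p\<in>I. A p < s (g p)) \<and> (\<forall>p\<in>T. is_record g r I A p)} =
    ennreal ((\<Prod>p\<in>I. s (g p)) * (\<Prod>p\<in>T. 1 / real (card (preds g r I p) + 1)))"
  using assms
proof (induction I arbitrary: T s rule: finite_ranking_induct[where f = r])
  case empty
  interpret product_prob_space "\<lambda>_::'i. U01" "{}"
    by (intro product_prob_spaceI prob_space_U01)
  show ?case using empty by (simp add: emeasure_space_1 space_PiM_empty PiM_empty)
next
  case (insert x I)
  show ?case
  proof (cases "x \<in> I")
    case True
    then show ?thesis using insert.IH[of T s] insert.prems by (simp add: insert_absorb)
  next
    case x: False
    interpret product_prob_space "\<lambda>_::'i. U01" I
      by (intro product_prob_spaceI prob_space_U01)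
    let ?P = "PiM I (\<lambda>_. U01)" and ?P' = "PiM (insert x I) (\<lambda>_. U01)"
    define X where "X = {A \<in> space ?P'. (\<forall>p\<in>insert x I. A p < s (g p)) \<and> (\<forall>p\<in>T. is_record g r (insert x I) A p)}"
    define T' where "T' = T - {x}"
    \<comment> \<open>Replacing the threshold \<open>s (g x)\<close> by \<open>y\<close> loses
      nothing, since the event also demands \<open>y < s (g x)\<close>.\<close>
    define s' where "s' = (\<lambda>y. if x \<in> T then s(g x := y) else s)"
    define k where "k = card (preds g r (insert x I) x)"
    define K where "K = (\<Prod>p\<in>T'. 1 / real (card (preds g r I p) + 1))"
    define R where "R = (\<Prod>p\<in>{p \<in> I. g p \<noteq> g x}. s (g p))"
    have T'I: "T' \<subseteq> I" using insert.prems(1) by (auto simp: T'_def)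
    have finT': "finite T'" by (rule finite_subset[OF T'I insert(1)])
    have preds_eq: "preds g r (insert x I) p = preds g r I p" if "p \<in> I" for p
      using insert(2)[OF that] by (auto simp: preds_def)
    \<comment> \<open>\<open>x\<close> has maximal rank, but other entries of its group are known to
      have a different rank only if \<open>x\<close> is in \<open>T\<close>.\<close>
    have preds_x: "preds g r (insert x I) x = {q \<in> I. g q = g x}" if "x \<in> T"
    proof -
      have "r q < r x" if "q \<in> I" "g q = g x" for q
        using insert(2)[OF that(1)] insert.prems(2)[OF \<open>x \<in> T\<close>, of q] that x by fastforce
      then show ?thesis using x by (auto simp: preds_def)
    qed
    have rec_upd: "is_record g r (insert x I) (w(x := y)) p \<longleftrightarrow> is_record g r I w p" if "p \<in> I" for p w and y :: real
      unfolding is_record_def preds_eq[OF that] using that x by (auto simp: preds_def)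
    have Xsets: "X \<in> sets ?P'"
      unfolding X_def by (rule records_below_sets) (use insert.prems(1) insert(1) in auto)
    have inner: "(\<integral>\<^sup>+ w. indicator X (w(x := y)) \<partial>?P) =
        indicator {..<s (g x)} y * ennreal ((\<Prod>p\<in>I. s' y (g p)) * K)" if y: "y \<in> {0..<1}" for y
    proof -
      define Z where "Z = {A \<in> space ?P. (\<forall>p\<in>I. A p < s' y (g p)) \<and> (\<forall>p\<in>T'. is_record g r I A p)}"
      have Z: "emeasure ?P Z = ennreal ((\<Prod>p\<in>I. s' y (g p)) * K)"
        unfolding Z_def K_def
      proof (rule insert.IH[OF T'I])
        show "\<And>p q. p \<in> T' \<Longrightarrow> q \<in> I \<Longrightarrow> q \<noteq> p \<Longrightarrow> g q = g p \<Longrightarrow> r q \<noteq> r p"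
          using insert.prems(2) by (auto simp: T'_def)
        show "\<And>c. 0 \<le> s' y c" "\<And>c. s' y c \<le> 1" using insert.prems(3,4) y by (auto simp: s'_def)
      qed
      have Zsets: "Z \<in> sets ?P"
        unfolding Z_def by (rule records_below_sets) (use T'I insert(1) in auto)
      have "indicator X (w(x := y)) = indicator {..<s (g x)} y * (indicator Z w :: ennreal)" if w: "w \<in> space ?P" for w
      proof -
        have sp: "w(x := y) \<in> space ?P'" using w unfolding space_PiM by (intro PiE_fun_upd) auto
        have recs: "(\<forall>p\<in>T. is_record g r (insert x I) (w(x := y)) p) \<longleftrightarrow>
            (\<forall>p\<in>T'. is_record g r I w p) \<and> (x \<in> T \<longrightarrow> (\<forall>q\<in>I. g q = g x \<longrightarrow> w q < y))"
        proof -
          have "(\<forall>p\<in>T. is_record g r (insert x I) (w(x := y)) p) \<longleftrightarrow>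
            (\<forall>p\<in>T'. is_record g r (insert x I) (w(x := y)) p) \<and> (x \<in> T \<longrightarrow> is_record g r (insert x I) (w(x := y)) x)"
            by (auto simp: T'_def)
          moreover have "is_record g r (insert x I) (w(x := y)) x \<longleftrightarrow> (\<forall>q\<in>I. g q = g x \<longrightarrow> w q < y)" if "x \<in> T"
            unfolding is_record_def preds_x[OF that] using x by auto
          ultimately show ?thesis using T'I rec_upd by blast
        qed
        have thr: "(\<forall>p\<in>insert x I. (w(x := y)) p < s (g p)) \<longleftrightarrow> y < s (g x) \<and> (\<forall>p\<in>I. w p < s (g p))"
          using x by auto
        have "w(x := y) \<in> X \<longleftrightarrow> y < s (g x) \<and> w \<in> Z"
          unfolding X_def Z_def mem_Collect_eq recs thr s'_def using sp w by auto
        then show ?thesis by (simp add: indicator_def)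
      qed
      then have "(\<integral>\<^sup>+ w. indicator X (w(x := y)) \<partial>?P) = (\<integral>\<^sup>+ w. indicator {..<s (g x)} y * indicator Z w \<partial>?P)"
        by (intro nn_integral_cong) simp
      also have "\<dots> = indicator {..<s (g x)} y * emeasure ?P Z"
        using Zsets by (simp add: nn_integral_cmult_indicator)
      finally show ?thesis using Z by simp
    qed
    have prod_split: "(\<Prod>p\<in>I. u (g p)) = u (g x) ^ k * (\<Prod>p\<in>{p \<in> I. g p \<noteq> g x}. u (g p))" if "x \<in> T" for u :: "'g \<Rightarrow> real"
    proof -
      have "I = {p \<in> I. g p = g x} \<union> {p \<in> I. g p \<noteq> g x}" by auto
      then have "(\<Prod>p\<in>I. u (g p)) = (\<Prod>p\<in>{p \<in> I. g p = g x} \<union> {p \<in> I. g p \<noteq> g x}. u (g p))" by simp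
      also have "\<dots> = (\<Prod>p\<in>{p \<in> I. g p = g x}. u (g p)) * (\<Prod>p\<in>{p \<in> I. g p \<noteq> g x}. u (g p))"
        by (rule prod.union_disjoint) (use insert(1) in auto)
      also have "(\<Prod>p\<in>{p \<in> I. g p = g x}. u (g p)) = u (g x) ^ k"
        by (simp add: k_def preds_x[OF that])
      finally show ?thesis .
    qed
    have "emeasure ?P' X = (\<integral>\<^sup>+ w. indicator X w \<partial>?P')" using Xsets by simp
    also have "\<dots> = (\<integral>\<^sup>+ y. (\<integral>\<^sup>+ w. indicator X (w(x := y)) \<partial>?P) \<partial>U01)"
      by (rule product_nn_integral_insert_rev[OF insert(1) x]) (use Xsets in auto)
    also have "\<dots> = (\<integral>\<^sup>+ y. indicator {..<s (g x)} y * ennreal ((\<Prod>p\<in>I. s' y (g p)) * K) \<partial>U01)"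
    proof (rule nn_integral_cong_AE)
      have "AE y in U01. y \<in> {0..<1}"
        by (rule AE_uniform_measureI) auto
      then show "AE y in U01. (\<integral>\<^sup>+ w. indicator X (w(x := y)) \<partial>?P) =
          indicator {..<s (g x)} y * ennreal ((\<Prod>p\<in>I. s' y (g p)) * K)"
        by eventually_elim (rule inner)
    qed
    also have "\<dots> = ennreal ((\<Prod>p\<in>insert x I. s (g p)) * (\<Prod>p\<in>T. 1 / real (card (preds g r (insert x I) p) + 1)))"
    proof -
      have K': "K = (\<Prod>p\<in>T'. 1 / real (card (preds g r (insert x I) p) + 1))"
        unfolding K_def by (rule prod.cong) (use T'I preds_eq in auto)
      have K0: "0 \<le> K" unfolding K_def by (intro prod_nonneg) simp
      have R0: "0 \<le> R" unfolding R_def by (intro prod_nonneg) (use insert.prems(3) in auto)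
      have s01: "0 \<le> s (g x)" "s (g x) \<le> 1" using insert.prems(3,4) by auto
      show ?thesis
      proof (cases "x \<in> T")
        case True
        have TT: "T = insert x T'" "x \<notin> T'" using True by (auto simp: T'_def)
        have "(\<integral>\<^sup>+ y. indicator {..<s (g x)} y * ennreal ((\<Prod>p\<in>I. s' y (g p)) * K) \<partial>U01) =
            (\<integral>\<^sup>+ y. ennreal (R * K) * (ennreal (y ^ k) * indicator {..<s (g x)} y) \<partial>U01)"
        proof (rule nn_integral_cong_AE)
          have "AE y in U01. y \<in> {0..<1}"
            by (rule AE_uniform_measureI) auto
          then show "AE y in U01. indicator {..<s (g x)} y * ennreal ((\<Prod>p\<in>I. s' y (g p)) * K) =
              ennreal (R * K) * (ennreal (y ^ k) * indicator {..<s (g x)} y)"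
          proof eventually_elim
            case (elim y)
            have "(\<Prod>p\<in>I. s' y (g p)) = y ^ k * R"
              unfolding prod_split[OF True] R_def s'_def using True by (auto intro!: prod.cong)
            then have "ennreal ((\<Prod>p\<in>I. s' y (g p)) * K) = ennreal (R * K) * ennreal (y ^ k)"
              using elim K0 R0 by (simp add: ennreal_mult[symmetric] mult_ac)
            then show ?case by (simp add: mult_ac)
          qed
        qed
        also have "\<dots> = ennreal (R * K) * (\<integral>\<^sup>+ y. ennreal (y ^ k) * indicator {..<s (g x)} y \<partial>U01)"
          by (rule nn_integral_cmult) simp
        \<comment> \<open>The integral of \<open>y ^ k\<close> supplies the threshold factors of
          \<open>x\<close> and its \<open>k\<close> predecessors together with the record
          probability \<open>1 / (k + 1)\<close>.\<close>
        also have "\<dots> = ennreal (R * K) * ennreal (s (g x) ^ Suc k / Suc k)"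
          by (subst nn_integral_U01_power) (use s01 in auto)
        also have "\<dots> = ennreal (R * K * (s (g x) ^ Suc k / Suc k))"
          using R0 K0 s01 by (intro ennreal_mult[symmetric]) auto
        also have "R * K * (s (g x) ^ Suc k / Suc k) =
            (\<Prod>p\<in>insert x I. s (g p)) * (\<Prod>p\<in>T. 1 / real (card (preds g r (insert x I) p) + 1))"
        proof -
          have "(\<Prod>p\<in>T. 1 / real (card (preds g r (insert x I) p) + 1)) = 1 / real (k + 1) * K"
            unfolding K' k_def by (subst TT(1), rule prod.insert[OF finT' TT(2)])
          moreover have "(\<Prod>p\<in>insert x I. s (g p)) = s (g x) * (s (g x) ^ k * R)"
            unfolding prod.insert[OF insert(1) x] prod_split[OF True] R_def ..
          ultimately show ?thesis by simp
        qed
        finally show ?thesis .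
      next
        case False
        then have TT: "T' = T" by (auto simp: T'_def)
        have C: "0 \<le> (\<Prod>p\<in>I. s (g p)) * K"
          using K0 insert.prems(3) by (auto intro!: mult_nonneg_nonneg prod_nonneg)
        have "(\<integral>\<^sup>+ y. indicator {..<s (g x)} y * ennreal ((\<Prod>p\<in>I. s' y (g p)) * K) \<partial>U01) =
            (\<integral>\<^sup>+ y. ennreal ((\<Prod>p\<in>I. s (g p)) * K) * (ennreal (y ^ 0) * indicator {..<s (g x)} y) \<partial>U01)"
          using False by (simp add: s'_def mult_ac)
        also have "\<dots> = ennreal ((\<Prod>p\<in>I. s (g p)) * K) * (\<integral>\<^sup>+ y. ennreal (y ^ 0) * indicator {..<s (g x)} y \<partial>U01)"
          by (rule nn_integral_cmult) simp
        also have "\<dots> = ennreal ((\<Prod>p\<in>I. s (g p)) * K) * ennreal (s (g x))"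
          by (subst nn_integral_U01_power) (use s01 in auto)
        also have "\<dots> = ennreal ((\<Prod>p\<in>I. s (g p)) * K * s (g x))"
          using C s01 by (intro ennreal_mult[symmetric]) auto
        also have "(\<Prod>p\<in>I. s (g p)) * K * s (g x) =
            (\<Prod>p\<in>insert x I. s (g p)) * (\<Prod>p\<in>T. 1 / real (card (preds g r (insert x I) p) + 1))"
          using insert(1) x by (simp add: K' TT mult_ac)
        finally show ?thesis .
      qed
    qed
    finally show ?thesis unfolding X_def .
  qed
qed


lemma AE_below_1:
  assumes "finite I"
  shows "AE A in PiM I (\<lambda>_. U01). \<forall>p\<in>I. A p < 1"
proof (rule AE_finite_allI[OF assms])
  fix p assume "p \<in> I"
  moreover have "AE y in U01. y < 1" by (rule AE_uniform_measureI) auto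
  ultimately show "AE A in PiM I (\<lambda>_. U01). A p < 1"
    by (intro AE_PiM_component[where P = "\<lambda>y. y < 1"] prob_space_U01)
qed

lemma prob_records:
  assumes "finite I" "T \<subseteq> I"
    and "\<And>p q. p \<in> T \<Longrightarrow> q \<in> I \<Longrightarrow> q \<noteq> p \<Longrightarrow> g q = g p \<Longrightarrow> r q \<noteq> r p"
  shows "measure (PiM I (\<lambda>_. U01)) {A \<in> space (PiM I (\<lambda>_. U01)). \<forall>p\<in>T. is_record g r I A p} =
    (\<Prod>p\<in>T. 1 / real (card (preds g r I p) + 1))" (is "measure ?P ?X = _")
proof -
  have Xs: "?X \<in> sets ?P"
    by (rule sets.sets_Collect_finite_All[OF is_record_sets]) (use assms finite_subset in auto)
  \<comment> \<open>Thresholds equal to 1 exclude only a null set.\<close>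
  have "emeasure ?P ?X = emeasure ?P {A \<in> space ?P. (\<forall>p\<in>I. A p < 1) \<and> (\<forall>p\<in>T. is_record g r I A p)}"
    by (rule emeasure_eq_AE)
      (use AE_below_1[OF assms(1)] Xs records_below_sets[OF assms(1,2)] in auto)
  also have "\<dots> = ennreal ((\<Prod>p\<in>I. 1) * (\<Prod>p\<in>T. 1 / real (card (preds g r I p) + 1)))"
    by (rule emeasure_records_below[where s = "\<lambda>_. 1", OF assms]) auto
  finally show ?thesis by (simp add: measure_def prod_nonneg)
qed

text \<open>Complements are removed one at a time: the pattern with \<open>x\<close> in
  \<open>N\<close> is the pattern that ignores \<open>x\<close> minus the one with \<open>x\<close>
  moved to \<open>T\<close>, which turns the factor \<open>1 / k\<close> into
  \<open>1 - 1 / k\<close>. Since \<open>T\<close> grows on the way, the induction keeps it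
  arbitrary.\<close>

lemma prob_record_pattern:
  assumes "finite I" "T \<subseteq> I" "N \<subseteq> I" "T \<inter> N = {}"
    and "\<And>p q. p \<in> T \<union> N \<Longrightarrow> q \<in> I \<Longrightarrow> q \<noteq> p \<Longrightarrow> g q = g p \<Longrightarrow> r q \<noteq> r p"
  shows "measure (PiM I (\<lambda>_. U01)) {A \<in> space (PiM I (\<lambda>_. U01)).
      (\<forall>p\<in>T. is_record g r I A p) \<and> (\<forall>p\<in>N. \<not> is_record g r I A p)} =
    (\<Prod>p\<in>T. 1 / real (card (preds g r I p) + 1)) * (\<Prod>p\<in>N. 1 - 1 / real (card (preds g r I p) + 1))"
proof -
  let ?P = "PiM I (\<lambda>_. U01)"
  let ?w = "\<lambda>p. 1 / real (card (preds g r I p) + 1)"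
  let ?X = "\<lambda>T N. {A \<in> space ?P. (\<forall>p\<in>T. is_record g r I A p) \<and> (\<forall>p\<in>N. \<not> is_record g r I A p)}"
  interpret P: prob_space ?P by (intro prob_space_PiM prob_space_U01)
  have "finite N" using assms finite_subset by auto
  then show ?thesis using assms(2-)
  proof (induction N arbitrary: T rule: finite_induct)
    case empty
    show ?case using prob_records[OF assms(1) empty(1), of g r] empty(4) by simp
  next
    case (insert x N)
    have sets: "?X T' N \<in> sets ?P" if "T' \<subseteq> I" for T'
    proof -
      have 1: "{A \<in> space ?P. \<forall>p\<in>T'. is_record g r I A p} \<in> sets ?P"
        by (rule sets.sets_Collect_finite_All[OF is_record_sets]) (use that assms(1) finite_subset in auto)
      have 2: "{A \<in> space ?P. \<forall>p\<in>N. \<not> is_record g r I A p} \<in> sets ?P"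
        by (rule sets.sets_Collect_finite_All[OF sets.sets_Collect_neg[OF is_record_sets]])
          (use insert.prems(2) insert(1) assms(1) in auto)
      show ?thesis by (rule sets.sets_Collect_conj[OF 2 1])
    qed
    have "?X T (insert x N) = ?X T N - ?X (insert x T) N" by auto
    then have m1: "measure ?P (?X T (insert x N)) = measure ?P (?X T N) - measure ?P (?X (insert x T) N)"
      using sets[of T] sets[of "insert x T"] insert.prems
      by (simp only:) (rule P.finite_measure_Diff, auto)
    have m2: "measure ?P (?X T N) = prod ?w T * (\<Prod>p\<in>N. 1 - ?w p)"
      by (rule insert.IH) (use insert.prems in auto)
    have m3: "measure ?P (?X (insert x T) N) = prod ?w (insert x T) * (\<Prod>p\<in>N. 1 - ?w p)"
      by (rule insert.IH) (use insert.prems insert.hyps in auto)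
    have m4: "prod ?w (insert x T) = ?w x * prod ?w T"
      using finite_subset[OF insert.prems(1) assms(1)] insert.prems(3) by (intro prod.insert) auto
    have m5: "(\<Prod>p\<in>insert x N. 1 - ?w p) = (1 - ?w x) * (\<Prod>p\<in>N. 1 - ?w p)"
      using insert.hyps by (intro prod.insert) auto
    have alg: "a * b - w * a * b = a * ((1 - w) * b)" for a b w :: real
      by (simp add: algebra_simps)
    show ?case unfolding m1 m2 m3 m4 m5 by (rule alg)
  qed
qed



text \<open>Make \<open>G\<close> one chain with \<open>x\<close> ranked last; the maximum of
  \<open>G\<close> is at \<open>x\<close> exactly if \<open>x\<close> is a record. All other entries
  share rank 0, as only the rank of \<open>x\<close> has to be distinguished.\<close>

lemma prob_max:
  assumes "finite I" "G \<subseteq> I" "x \<in> G"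
  shows "measure (PiM I (\<lambda>_. U01)) {A \<in> space (PiM I (\<lambda>_. U01)). \<forall>z\<in>G - {x}. A z < A x} = 1 / real (card G)"
proof -
  let ?g = "\<lambda>z. z \<in> G" and ?r = "\<lambda>z. if z = x then 1 else (0::nat)"
  have fin: "finite G" using assms finite_subset by auto
  have p: "preds ?g ?r I x = G - {x}" using assms by (auto simp: preds_def)
  have "card G > 0" using assms(3) fin by (auto simp: card_gt_0_iff)
  then have c: "card (preds ?g ?r I x) + 1 = card G" unfolding p using assms(3) fin by simp
  have "measure (PiM I (\<lambda>_. U01)) {A \<in> space (PiM I (\<lambda>_. U01)). \<forall>q\<in>{x}. is_record ?g ?r I A q} =
      (\<Prod>q\<in>{x}. 1 / real (card (preds ?g ?r I q) + 1))"
    by (rule prob_records) (use assms in auto)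
  also have "\<dots> = 1 / real (card G)" using c by simp
  also have "{A \<in> space (PiM I (\<lambda>_. U01)). \<forall>q\<in>{x}. is_record ?g ?r I A q} =
      {A \<in> space (PiM I (\<lambda>_. U01)). \<forall>z\<in>G - {x}. A z < A x}"
    unfolding is_record_def using p by auto
  finally show ?thesis .
qed

text \<open>In the chain \<open>G\<close> with \<open>y\<close> ranked last and \<open>x\<close>
  just before it, the event says that both are records; their independence gives the two
  factors.\<close>

lemma prob_max_except_one:
  assumes "finite I" "G \<subseteq> I" "x \<in> G" "y \<in> G" "x \<noteq> y"
  shows "measure (PiM I (\<lambda>_. U01))
      {A \<in> space (PiM I (\<lambda>_. U01)). (\<forall>z\<in>G - {x, y}. A z < A x) \<and> A x < A y} =
    1 / (real (card G) * (real (card G) - 1))"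
proof -
  define g where "g = (\<lambda>z. z \<in> G)"
  define r where "r = (\<lambda>z. if z = y then 2 else if z = x then 1 else (0::nat))"
  have fin: "finite G" using assms finite_subset by auto
  have gG: "q \<in> I \<and> g q = g p \<longleftrightarrow> q \<in> G" if "p \<in> G" for p q
    using that assms(2) by (auto simp: g_def)
  have px: "preds g r I x = G - {x, y}"
    unfolding preds_def using gG[OF assms(3)] assms(5) by (auto simp: r_def split: if_splits)
  have py: "preds g r I y = G - {y}"
    unfolding preds_def using gG[OF assms(4)] assms(5) by (auto simp: r_def split: if_splits)
  have "card {x, y} \<le> card G" by (rule card_mono) (use assms fin in auto)
  then have c2: "2 \<le> card G" using assms(5) by simp
  have cx: "real (card (preds g r I x) + 1) = real (card G) - 1"
    using assms fin c2 unfolding px by (simp add: card_Diff_subset)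
  have cy: "real (card (preds g r I y) + 1) = real (card G)"
    using assms fin c2 unfolding py by simp
  have "measure (PiM I (\<lambda>_. U01)) {A \<in> space (PiM I (\<lambda>_. U01)). \<forall>q\<in>{x, y}. is_record g r I A q} =
      (\<Prod>q\<in>{x, y}. 1 / real (card (preds g r I q) + 1))"
    by (rule prob_records) (use assms in \<open>auto simp: g_def r_def split: if_splits\<close>)
  also have "\<dots> = 1 / (real (card G) * (real (card G) - 1))"
    using assms(5) cx cy by simp
  also have "{A \<in> space (PiM I (\<lambda>_. U01)). \<forall>q\<in>{x, y}. is_record g r I A q} =
      {A \<in> space (PiM I (\<lambda>_. U01)). (\<forall>z\<in>G - {x, y}. A z < A x) \<and> A x < A y}"
  proof -
    have "(\<forall>q\<in>{x, y}. is_record g r I A q) \<longleftrightarrow> (\<forall>z\<in>G - {x, y}. A z < A x) \<and> A x < A y" for A :: "'a \<Rightarrow> real"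
    proof -
      have "(\<forall>q\<in>{x, y}. is_record g r I A q) \<longleftrightarrow> (\<forall>z\<in>G - {x, y}. A z < A x) \<and> (\<forall>z\<in>G - {y}. A z < A y)"
        by (simp add: is_record_def px py)
      also have "\<dots> \<longleftrightarrow> (\<forall>z\<in>G - {x, y}. A z < A x) \<and> A x < A y"
      proof (intro conj_cong refl iffI ballI)
        fix z assume "\<forall>z\<in>G - {x, y}. A z < A x" "A x < A y" "z \<in> G - {y}"
        then show "A z < A y" by (cases "z = x") (auto intro: less_trans)
      qed (use assms(3,5) in auto)
      finally show ?thesis .
    qed
    then show ?thesis by (simp only:)
  qed
  finally show ?thesis .
qed

text \<open>For two positions the events \<open>A x < A y\<close> and \<open>A y < A x\<close> are
  disjoint and have probability 1/2 each by \<open>prob_max\<close>, which leaves nothing for a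
  tie.\<close>

lemma AE_inj_on:
  assumes "finite I"
  shows "AE A in PiM I (\<lambda>_. U01). inj_on A I"
proof -
  let ?P = "PiM I (\<lambda>_. U01)"
  interpret P: prob_space ?P by (intro prob_space_PiM prob_space_U01)
  note [measurable] = measurable_component_U01
  have ne: "AE A in ?P. A x \<noteq> A y" if xy: "x \<in> I" "y \<in> I" "x \<noteq> y" for x y
  proof -
    have half: "measure ?P {A \<in> space ?P. A u < A v} = 1/2" if "u \<in> I" "v \<in> I" "u \<noteq> v" for u v
    proof -
      have "{u, v} - {v} = {u}" using that by auto
      then show ?thesis using prob_max[of I "{u, v}" v] that assms by simp
    qed
    have "measure ?P ({A \<in> space ?P. A x < A y} \<union> {A \<in> space ?P. A y < A x}) = 1"
      using half[of x y] half[of y x] xy by (subst P.finite_measure_Union) auto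
    then have "AE A in ?P. A \<in> {A \<in> space ?P. A x < A y} \<union> {A \<in> space ?P. A y < A x}"
      using xy by (subst (asm) P.prob_eq_1) auto
    then show ?thesis by eventually_elim auto
  qed
  have "AE A in ?P. \<forall>x\<in>I. \<forall>y\<in>I. x \<noteq> y \<longrightarrow> A x \<noteq> A y"
    by (intro AE_finite_allI assms) (use ne in auto)
  then show ?thesis by eventually_elim (auto simp: inj_on_def)
qed

section \<open>Encodings from rare events\<close>

lemma random_array_eq: "random_array m n = PiM (positions m n) (\<lambda>_. U01)"
  by (simp add: random_array_def)

lemma finite_positions [simp]: "finite (positions m n)"
  by (simp add: positions_def)

text \<open>The choice operator receives the same predicate for both arrays, so the agreement
  includes the breaking of ties. Hence the order pattern is a valid label even for arrays with
  ties.\<close>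

lemma RMQ_cong_order:
  assumes "\<And>x y. x \<in> q \<Longrightarrow> y \<in> q \<Longrightarrow> A x < A y \<longleftrightarrow> A' x < A' y"
  shows "RMQ A q = RMQ A' q"
proof -
  have "is_arg_max A (\<lambda>x. x \<in> q) = is_arg_max A' (\<lambda>x. x \<in> q)"
    using assms by (auto simp: is_arg_max_def fun_eq_iff)
  then show ?thesis by (simp add: RMQ_def arg_max_on_def arg_max_def)
qed

lemma sets_Collect_Ball2:
  assumes "finite P" "\<And>x y. x \<in> P \<Longrightarrow> y \<in> P \<Longrightarrow> {A \<in> space M. R x y A} \<in> sets M"
  shows "{A \<in> space M. \<forall>x\<in>P. \<forall>y\<in>P. R x y A} \<in> sets M"
  by (rule sets.sets_Collect_finite_All[OF sets.sets_Collect_finite_All]) (use assms in auto)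

text \<open>Expansion of the product of the factors \<open>w t + (1 - w t)\<close>: the total mass
  of a product of Bernoulli distributions.\<close>

lemma sum_prod_Bernoulli:
  fixes w :: "'t \<Rightarrow> real"
  assumes "finite T"
  shows "(\<Sum>S\<in>Pow T. prod w S * (\<Prod>t\<in>T - S. 1 - w t)) = 1"
  using prod_add[OF assms, of w "\<lambda>t. 1 - w t"] by simp

text \<open>The price of an event that does not occur. It is linear in the weight as long as the
  weight stays away from 1.\<close>

lemma minus_log2_one_minus_le:
  assumes "0 \<le> w" "w \<le> 1/2"
  shows "- log 2 (1 - w) \<le> 4 * (w :: real)"
proof -
  have "- w - 2 * w\<^sup>2 \<le> ln (1 - w)"
    using ln_one_minus_pos_lower_bound assms by simp
  moreover have "2 * w\<^sup>2 \<le> w" using assms mult_right_mono[of w "1/2" w] by (simp add: power2_eq_square)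
  ultimately have "- ln (1 - w) \<le> 2 * w" by simp
  also have "\<dots> \<le> 4 * w * ln 2"
  proof -
    have "2 * w * (2/3) \<le> 2 * w * ln 2" by (rule mult_left_mono) (use ln2_ge_two_thirds assms in auto)
    then show ?thesis using assms by simp
  qed
  finally show ?thesis by (simp add: log_def field_simps)
qed

text \<open>A Shannon code for the product distribution with weights
  \<open>1 / (2 * \<kappa> t)\<close>: an event costs \<open>1 + log 2 (\<kappa> t)\<close> bits if
  it occurs and at most \<open>2 / \<kappa> t\<close> bits if it does not. The slack 8 allows
  \<open>\<kappa>\<close> to be a simple expression of the right order instead of the exact inverse
  probability.\<close>

lemma expected_effective_entropy_le:
  fixes E :: "'t \<Rightarrow> (nat \<times> nat \<Rightarrow> real) \<Rightarrow> bool" and \<kappa> :: "'t \<Rightarrow> real"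
  assumes finT: "finite T"
    and meas: "\<And>t. t \<in> T \<Longrightarrow> {A \<in> arrays m n. E t A} \<in> sets (random_array m n)"
    and \<kappa>: "\<And>t. t \<in> T \<Longrightarrow> 1 \<le> \<kappa> t"
    and prob: "\<And>t. t \<in> T \<Longrightarrow> measure (random_array m n) {A \<in> arrays m n. E t A} \<le> 8 / \<kappa> t"
    and det: "\<And>A A' q. A \<in> arrays m n \<Longrightarrow> A' \<in> arrays m n \<Longrightarrow> inj_on A (positions m n) \<Longrightarrow>
      inj_on A' (positions m n) \<Longrightarrow> (\<And>t. t \<in> T \<Longrightarrow> E t A \<longleftrightarrow> E t A') \<Longrightarrow> q \<in> Q \<Longrightarrow> RMQ A q = RMQ A' q"
    and Q: "\<And>q. q \<in> Q \<Longrightarrow> q \<subseteq> positions m n"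
  shows "expected_effective_entropy m n Q \<le> ennreal (2 + (\<Sum>t\<in>T. 10 * (1 + log 2 (\<kappa> t)) / \<kappa> t))"
proof -
  define P where "P = positions m n"
  define M where "M = random_array m n"
  interpret prob_space M unfolding M_def by (rule prob_space_random_array)
  have spM: "space M = arrays m n" by (simp add: M_def space_random_array)
  have finP: "finite P" by (simp add: P_def)
  have Es: "{A \<in> space M. E t A} \<in> sets M" if "t \<in> T" for t using meas[OF that] spM by (simp add: M_def)
  define S where "S A = {t \<in> T. E t A}" for A
  define ord where "ord A = {(x, y) \<in> P \<times> P. A x < A y}" for A :: "nat \<times> nat \<Rightarrow> real"
  define v where "v A = (if inj_on A P then Inl (S A) else Inr (ord A))" for A
  define L where "L = Pow T <+> Pow (P \<times> P)"
  \<comment> \<open>The factor 2 keeps every weight at most 1/2, so that both outcomes of an event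
    have positive weight and non-occurrence is cheap.\<close>
  define w where "w t = 1 / (2 * \<kappa> t)" for t
  \<comment> \<open>Arrays with ties are a null set, but have to be encoded correctly as well: half of the code
    space is reserved for their order patterns.\<close>
  define W :: "'t set + ((nat \<times> nat) \<times> (nat \<times> nat)) set \<Rightarrow> real" where
    "W = case_sum (\<lambda>S. 1/2 * (prod w S * (\<Prod>t\<in>T - S. 1 - w t))) (\<lambda>_. 1/2 * (1/2) ^ card (P \<times> P))"
  \<comment> \<open>Shannon code lengths. The ceiling costs at most one bit and the factor 1/2 in
    \<open>W\<close> another; this is the additive 2 of the bound.\<close>
  define l where "l x = nat \<lceil>- log 2 (W x)\<rceil>" for x
  have finL: "finite L" using finT finP by (simp add: L_def)
  have vL: "v A \<in> L" for A by (auto simp: v_def L_def S_def ord_def)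
  have w: "0 < w t" "w t \<le> 1/2" if "t \<in> T" for t
    using \<kappa>[OF that] by (auto simp: w_def field_simps)
  have \<kappa>0: "0 \<le> 2 / \<kappa> t" if "t \<in> T" for t using \<kappa>[OF that] by simp
  have gain: "0 \<le> indicator {A \<in> space M. E t A} A * (1 + log 2 (\<kappa> t))" if "t \<in> T" for t A
    using \<kappa>[OF that] by (intro mult_nonneg_nonneg) auto
  have sumW: "(\<Sum>x\<in>L. W x) = 1"
    unfolding L_def using finT finP sum_prod_Bernoulli[OF finT, of w]
    by (subst sum.Plus) (simp_all add: W_def sum_distrib_left[symmetric] sum_divide_distrib[symmetric] card_Pow power_divide)
  have Wpos: "0 < W x" if "x \<in> L" for x
    using that w by (force simp: L_def W_def intro!: mult_pos_pos prod_pos)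
  \<comment> \<open>A label of weight 1 would get the empty codeword; the bound 1/2 forces every
    length to be at least 1.\<close>
  have Whalf: "W x \<le> 1/2" if "x \<in> L" for x
  proof (cases x)
    case (Inl U)
    then have U: "U \<subseteq> T" using that by (auto simp: L_def)
    have "prod w U \<le> 1" by (rule prod_le_1) (use w U in force)
    moreover have "(\<Prod>t\<in>T - U. 1 - w t) \<le> 1" by (rule prod_le_1) (use w in force)
    moreover have "0 \<le> prod w U" by (rule prod_nonneg) (use w U in force)
    moreover have "0 \<le> (\<Prod>t\<in>T - U. 1 - w t)" by (rule prod_nonneg) (use w in force)
    ultimately have "prod w U * (\<Prod>t\<in>T - U. 1 - w t) \<le> 1" by (intro mult_le_one)
    then show ?thesis by (simp add: Inl W_def)
  next
    case (Inr U)
    then show ?thesis by (simp add: W_def power_le_one)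
  qed
  have l_W: "(1/2) ^ l x \<le> W x" if "x \<in> L" for x
  proof -
    have "- log 2 (W x) \<le> real (l x)" unfolding l_def by (rule real_nat_ceiling_ge)
    then have "2 powr (- real (l x)) \<le> 2 powr (log 2 (W x))" by simp
    then show ?thesis using Wpos[OF that] by (simp add: powr_minus powr_realpow power_one_over inverse_eq_divide)
  qed
  have l_pos: "1 \<le> l x" if "x \<in> L" for x
  proof -
    have "log 2 (W x) \<le> log 2 (1/2)" using Whalf[OF that] Wpos[OF that] by simp
    then have "1 \<le> - log 2 (W x)" by (simp add: log_divide)
    then have "1 \<le> real (l x)" using real_nat_ceiling_ge[of "- log 2 (W x)"] unfolding l_def by linarith
    then show ?thesis by simp
  qed
  have "(\<Sum>x\<in>L. (1/2::real) ^ l x) \<le> 1"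
    using sum_mono[of L "\<lambda>x. (1/2::real) ^ l x" W] l_W sumW by simp
  from prefix_code_exists[OF finL this] obtain f :: "_ \<Rightarrow> bool list" where f:
    "(\<forall>x\<in>L. length (f x) = l x) \<and> (\<forall>x\<in>L. \<forall>y\<in>L. prefix (f x) (f y) \<longrightarrow> x = y)" ..
  have len: "length (f x) = l x" if "x \<in> L" for x using f that by blast
  have pf: "x = y" if "x \<in> L" "y \<in> L" "prefix (f x) (f y)" for x y using f that by blast
  define enc where "enc A = f (v A)" for A
  have "enc \<in> encodings m n Q"
    unfolding encodings_def mem_Collect_eq
  proof (intro conjI)
    have inj: "{A \<in> space M. inj_on A P} \<in> sets M"
      unfolding inj_on_def
    proof (rule sets_Collect_Ball2[OF finP])
      fix x y assume "x \<in> P" "y \<in> P"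
      then have "{A \<in> space M. A x \<noteq> A y} \<in> sets M"
        unfolding M_def random_array_eq P_def by (intro borel_measurable_neq measurable_component_U01)
      then show "{A \<in> space M. A x = A y \<longrightarrow> x = y} \<in> sets M" by (cases "x = y") simp_all
    qed
    have "v -` {x} \<inter> space M \<in> sets M" if "x \<in> L" for x
    proof (cases x)
      case (Inl U)
      then have U: "U \<subseteq> T" using that by (auto simp: L_def)
      have "{A \<in> space M. E t A \<longleftrightarrow> t \<in> U} \<in> sets M" if "t \<in> T" for t
        using Es[OF that] sets.sets_Collect_neg[OF Es[OF that]] by (cases "t \<in> U") simp_all
      then have *: "{A \<in> space M. \<forall>t\<in>T. E t A \<longleftrightarrow> t \<in> U} \<in> sets M"
        by (rule sets.sets_Collect_finite_All[OF _ finT])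
      have "v -` {x} \<inter> space M = {A \<in> space M. inj_on A P \<and> (\<forall>t\<in>T. E t A \<longleftrightarrow> t \<in> U)}"
        unfolding Inl using U by (auto 4 4 simp: v_def S_def set_eq_iff split: if_splits)
      then show ?thesis using sets.sets_Collect_conj[OF * inj] by simp
    next
      case (Inr U)
      then have U: "U \<subseteq> P \<times> P" using that by (auto simp: L_def)
      have *: "{A \<in> space M. \<forall>x\<in>P. \<forall>y\<in>P. A x < A y \<longleftrightarrow> (x, y) \<in> U} \<in> sets M"
      proof (rule sets_Collect_Ball2[OF finP])
        fix x y assume "x \<in> P" "y \<in> P"
        then have less: "{A \<in> space M. A x < A y} \<in> sets M"
          unfolding M_def random_array_eq P_def by (intro borel_measurable_less measurable_component_U01)
        from less sets.sets_Collect_neg[OF less] show "{A \<in> space M. A x < A y \<longleftrightarrow> (x, y) \<in> U} \<in> sets M" by (cases "(x, y) \<in> U") simp_all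
      qed
      have "v -` {x} \<inter> space M = {A \<in> space M. \<not> inj_on A P \<and> (\<forall>x\<in>P. \<forall>y\<in>P. A x < A y \<longleftrightarrow> (x, y) \<in> U)}"
      proof -
        have "ord A = U \<longleftrightarrow> (\<forall>x\<in>P. \<forall>y\<in>P. A x < A y \<longleftrightarrow> (x, y) \<in> U)" for A
        proof
          assume r: "\<forall>x\<in>P. \<forall>y\<in>P. A x < A y \<longleftrightarrow> (x, y) \<in> U"
          have "z \<in> ord A \<longleftrightarrow> z \<in> U" if "z \<in> P \<times> P" for z using r that by (auto simp: ord_def)
          moreover have "ord A \<subseteq> P \<times> P" by (auto simp: ord_def)
          ultimately show "ord A = U" using U by blast
        qed (auto simp: ord_def)
        then show ?thesis unfolding Inr by (auto simp: v_def split: if_splits)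
      qed
      then show ?thesis using sets.sets_Collect_conj[OF * sets.sets_Collect_neg[OF inj]] by simp
    qed
    then have "v \<in> M \<rightarrow>\<^sub>M count_space L"
      using finL vL by (subst measurable_count_space_eq2) auto
    moreover have "f \<in> count_space L \<rightarrow>\<^sub>M count_space UNIV" by simp
    ultimately show "enc \<in> random_array m n \<rightarrow>\<^sub>M count_space UNIV"
      unfolding enc_def M_def by (rule measurable_compose)
    show "uniquely_decodable (enc ` arrays m n)"
    proof (rule uniquely_decodable_prefix_free)
      show "[] \<notin> enc ` arrays m n"
      proof
        assume "[] \<in> enc ` arrays m n"
        then obtain A where "[] = f (v A)" by (auto simp: enc_def)
        then show False using len[OF vL[of A]] l_pos[OF vL[of A]] by simp
      qed
      show "u = u'" if "u \<in> enc ` arrays m n" "u' \<in> enc ` arrays m n" "prefix u u'" for u u'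
        using that by (auto simp: enc_def dest!: pf[OF vL vL])
    qed
    \<comment> \<open>Any array with the given codeword can stand in for the original one, since
      equal codewords mean equal labels and equal labels mean equal answers.\<close>
    define dec where "dec c q = RMQ (SOME A. A \<in> arrays m n \<and> enc A = c) q" for c q
    have "dec (enc A) q = RMQ A q" if A: "A \<in> arrays m n" and q: "q \<in> Q" for A q
    proof -
      define A' where "A' = (SOME A'. A' \<in> arrays m n \<and> enc A' = enc A)"
      have A': "A' \<in> arrays m n" "enc A' = enc A"
        unfolding A'_def by (rule someI2[where a = A]; use A in simp)+
      have v: "v A' = v A" using A'(2) by (intro pf[OF vL vL]) (simp add: enc_def)
      have "RMQ A' q = RMQ A q"
      proof (cases "inj_on A P")
        case True
        with v have inj': "inj_on A' P" and "S A' = S A" by (auto simp: v_def split: if_splits)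
        then have "E t A' \<longleftrightarrow> E t A" if "t \<in> T" for t using that by (auto simp: S_def)
        then show ?thesis using det[OF A'(1) A _ _ _ q] True inj' by (simp add: P_def)
      next
        case False
        with v have "ord A' = ord A" by (auto simp: v_def split: if_splits)
        then show ?thesis using Q[OF q] by (intro RMQ_cong_order) (auto simp: ord_def P_def)
      qed
      then show ?thesis by (simp add: dec_def A'_def)
    qed
    then show "\<exists>dec. \<forall>A\<in>arrays m n. \<forall>q\<in>Q. dec (enc A) q = RMQ A q" by blast
  qed
  then have "expected_effective_entropy m n Q \<le> expected_bits m n enc"
    unfolding expected_effective_entropy_def by (rule INF_lower)
  also have "\<dots> \<le> (\<integral>\<^sup>+ A. ennreal (2 + (\<Sum>t\<in>T. indicator {A \<in> space M. E t A} A * (1 + log 2 (\<kappa> t)) + 2 / \<kappa> t)) \<partial>M)"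
    unfolding expected_bits_def M_def[symmetric]
  proof (rule nn_integral_mono_AE)
    have "AE A in M. inj_on A P" unfolding M_def P_def random_array_eq by (rule AE_inj_on) simp
    moreover have "AE A in M. A \<in> space M" by simp
    ultimately show "AE A in M. of_nat (length (enc A)) \<le>
        ennreal (2 + (\<Sum>t\<in>T. indicator {A \<in> space M. E t A} A * (1 + log 2 (\<kappa> t)) + 2 / \<kappa> t))"
    proof eventually_elim
      case (elim A)
      let ?c = "\<lambda>t. indicator {A \<in> space M. E t A} A * (1 + log 2 (\<kappa> t)) + 2 / \<kappa> t"
      have vA: "v A = Inl (S A)" using elim by (simp add: v_def)
      have ST: "S A \<subseteq> T" by (auto simp: S_def)
      have p1: "0 < prod w (S A)" by (rule prod_pos) (use w ST in auto)
      have p2: "0 < (\<Prod>t\<in>T - S A. 1 - w t)" by (rule prod_pos) (use w in force)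
      have lw: "- log 2 (w t) = 1 + log 2 (\<kappa> t)" if "t \<in> T" for t
        using \<kappa>[OF that] by (simp add: w_def log_divide log_mult)
      have "- log 2 (W (v A)) = 1 + (\<Sum>t\<in>S A. - log 2 (w t)) + (\<Sum>t\<in>T - S A. - log 2 (1 - w t))"
      proof -
        have "log 2 (prod w (S A)) = (\<Sum>t\<in>S A. log 2 (w t))"
          unfolding log_def by (subst ln_prod) (use w(1) ST finite_subset[OF ST finT] in \<open>force simp: sum_divide_distrib\<close>)+
        moreover have "log 2 (\<Prod>t\<in>T - S A. 1 - w t) = (\<Sum>t\<in>T - S A. log 2 (1 - w t))"
          unfolding log_def by (subst ln_prod) (use w finT in \<open>force simp: sum_divide_distrib\<close>)+
        ultimately show ?thesis using p1 p2 unfolding vA W_def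
          by (simp add: log_mult log_divide sum_negf)
      qed
      also have "(\<Sum>t\<in>S A. - log 2 (w t)) \<le> (\<Sum>t\<in>S A. ?c t)"
      proof (rule sum_mono)
        fix t assume t: "t \<in> S A"
        then have "t \<in> T" "indicator {A \<in> space M. E t A} A = (1::real)" using elim by (auto simp: S_def)
        then show "- log 2 (w t) \<le> ?c t" using lw[of t] \<kappa>[of t] by simp
      qed
      also have "(\<Sum>t\<in>T - S A. - log 2 (1 - w t)) \<le> (\<Sum>t\<in>T - S A. ?c t)"
      proof (rule sum_mono)
        fix t assume t: "t \<in> T - S A"
        have "- log 2 (1 - w t) \<le> 4 * w t" by (rule minus_log2_one_minus_le) (use w[of t] t in auto)
        also have "\<dots> = 2 / \<kappa> t" by (simp add: w_def)
        also have "\<dots> \<le> ?c t" using gain[of t A] t by simp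
        finally show "- log 2 (1 - w t) \<le> ?c t" .
      qed
      finally have "- log 2 (W (v A)) \<le> 1 + (\<Sum>t\<in>S A. ?c t) + (\<Sum>t\<in>T - S A. ?c t)" by simp
      also have "\<dots> = 1 + (\<Sum>t\<in>T. ?c t)"
        using sum.subset_diff[OF ST finT, of ?c] by simp
      finally have main: "- log 2 (W (v A)) \<le> 1 + (\<Sum>t\<in>T. ?c t)" .
      have nn: "0 \<le> (\<Sum>t\<in>T. ?c t)"
        by (intro sum_nonneg add_nonneg_nonneg gain \<kappa>0)
      have "real (length (enc A)) = real (nat \<lceil>- log 2 (W (v A))\<rceil>)"
        by (simp add: enc_def len[OF vL] l_def)
      also have "\<dots> \<le> 2 + (\<Sum>t\<in>T. ?c t)" using main nn by linarith
      finally have "real (length (enc A)) \<le> 2 + (\<Sum>t\<in>T. ?c t)" .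
      then show ?case by (subst ennreal_of_nat_eq_real_of_nat) (rule ennreal_leI)
    qed
  qed
  also have "\<dots> = ennreal (2 + (\<Sum>t\<in>T. prob {A \<in> space M. E t A} * (1 + log 2 (\<kappa> t)) + 2 / \<kappa> t))"
  proof -
    have int: "integrable M (\<lambda>A. indicator {A \<in> space M. E t A} A * (1 + log 2 (\<kappa> t)))" if "t \<in> T" for t
      using Es[OF that] by (intro integrable_mult_left) (simp add: emeasure_eq_measure)
    have "integrable M (\<lambda>A. 2 + (\<Sum>t\<in>T. indicator {A \<in> space M. E t A} A * (1 + log 2 (\<kappa> t)) + 2 / \<kappa> t))"
      using int by (intro Bochner_Integration.integrable_add Bochner_Integration.integrable_sum integrable_const) auto
    moreover have "(\<integral>A. 2 + (\<Sum>t\<in>T. indicator {A \<in> space M. E t A} A * (1 + log 2 (\<kappa> t)) + 2 / \<kappa> t) \<partial>M) =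
        2 + (\<Sum>t\<in>T. prob {A \<in> space M. E t A} * (1 + log 2 (\<kappa> t)) + 2 / \<kappa> t)"
      using int Es by (simp add: Bochner_Integration.integral_add Bochner_Integration.integral_sum prob_space)
    moreover have "0 \<le> 2 + (\<Sum>t\<in>T. indicator {A \<in> space M. E t A} A * (1 + log 2 (\<kappa> t)) + 2 / \<kappa> t)" for A
      by (intro add_nonneg_nonneg sum_nonneg gain \<kappa>0) simp_all
    ultimately show ?thesis by (subst nn_integral_eq_integral) auto
  qed
  \<comment> \<open>The 10 is 8 for occurrence plus 2 for non-occurrence, the latter enlarged by
    \<open>1 + log 2 (\<kappa> t)\<close>, which is at least 1.\<close>
  also have "\<dots> \<le> ennreal (2 + (\<Sum>t\<in>T. 10 * (1 + log 2 (\<kappa> t)) / \<kappa> t))"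
  proof (intro ennreal_leI add_left_mono sum_mono)
    fix t assume t: "t \<in> T"
    have "prob {A \<in> space M. E t A} * (1 + log 2 (\<kappa> t)) \<le> 8 / \<kappa> t * (1 + log 2 (\<kappa> t))"
      using prob[OF t] \<kappa>[OF t] by (intro mult_right_mono) (auto simp: M_def space_random_array)
    moreover have "2 / \<kappa> t \<le> 2 / \<kappa> t * (1 + log 2 (\<kappa> t))" using \<kappa>[OF t] by (simp add: field_simps)
    moreover have "10 * (1 + log 2 (\<kappa> t)) / \<kappa> t = 8 / \<kappa> t * (1 + log 2 (\<kappa> t)) + 2 / \<kappa> t * (1 + log 2 (\<kappa> t))"
      by (simp add: add_divide_distrib ring_distribs)
    ultimately show "prob {A \<in> space M. E t A} * (1 + log 2 (\<kappa> t)) + 2 / \<kappa> t \<le> 10 * (1 + log 2 (\<kappa> t)) / \<kappa> t"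
      by linarith
  qed
  finally show ?thesis .
qed

section \<open>A lower bound from records\<close>

lemma RMQ_is_max:
  assumes "finite q" "q \<noteq> {}"
  shows "RMQ A q \<in> q" and "y \<in> q \<Longrightarrow> A y \<le> A (RMQ A q)"
proof -
  have "Max (A ` q) \<in> A ` q" using assms by (intro Max_in) auto
  then obtain x where "x \<in> q" "A x = Max (A ` q)" by auto
  then have "is_arg_max A (\<lambda>x. x \<in> q) x" using assms(1) by (auto simp: is_arg_max_def not_less)
  then have "is_arg_max A (\<lambda>x. x \<in> q) (RMQ A q)"
    unfolding RMQ_def arg_max_on_def arg_max_def by (rule someI)
  then show "RMQ A q \<in> q" "y \<in> q \<Longrightarrow> A y \<le> A (RMQ A q)"
    by (simp_all add: is_arg_max_def not_less del: split_paired_All split_paired_Ex)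
qed

lemma RMQ_eq_iff:
  assumes "finite q" "x \<in> q" "inj_on A q"
  shows "RMQ A q = x \<longleftrightarrow> (\<forall>y\<in>q - {x}. A y < A x)"
proof -
  have neq: "A y \<noteq> A z" if "y \<in> q" "z \<in> q" "y \<noteq> z" for y z
    using assms(3) that by (auto simp: inj_on_def)
  have "q \<noteq> {}" using assms(2) by auto
  note max = RMQ_is_max[OF assms(1) this, where A = A]
  show ?thesis
  proof
    assume "RMQ A q = x"
    then show "\<forall>y\<in>q - {x}. A y < A x" using max(2) neq[OF _ assms(2)] by (force simp: less_le)
  next
    assume less: "\<forall>y\<in>q - {x}. A y < A x"
    show "RMQ A q = x"
    proof (rule ccontr)
      assume "RMQ A q \<noteq> x"
      then have "A (RMQ A q) < A x" using less max(1) by blast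
      with max(2)[OF assms(2)] show False by simp
    qed
  qed
qed

text \<open>A marginal of the product distribution: replacing \<open>1 - w p\<close> by 0 kills the
  subsets without \<open>p\<close>, and in the factored sum only the factor \<open>w p\<close>
  differs from 1.\<close>

lemma sum_prod_Bernoulli_mem:
  fixes w :: "'t \<Rightarrow> real"
  assumes "finite T" "p \<in> T"
  shows "(\<Sum>S\<in>Pow T. if p \<in> S then prod w S * (\<Prod>t\<in>T - S. 1 - w t) else 0) = w p"
proof -
  define u where "u t = (if t = p then 0 else 1 - w t)" for t
  have "(\<Sum>S\<in>Pow T. if p \<in> S then prod w S * (\<Prod>t\<in>T - S. 1 - w t) else 0) =
      (\<Sum>S\<in>Pow T. prod w S * prod u (T - S))"
  proof (rule sum.cong[OF refl])
    fix S assume S: "S \<in> Pow T"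
    show "(if p \<in> S then prod w S * (\<Prod>t\<in>T - S. 1 - w t) else 0) = prod w S * prod u (T - S)"
    proof (cases "p \<in> S")
      case True
      then have "prod u (T - S) = (\<Prod>t\<in>T - S. 1 - w t)" by (intro prod.cong) (auto simp: u_def)
      with True show ?thesis by simp
    next
      case False
      then have "prod u (T - S) = 0" using assms by (intro prod_zero) (auto simp: u_def)
      with False show ?thesis by simp
    qed
  qed
  also have "\<dots> = (\<Prod>t\<in>T. w t + u t)" using prod_add[OF assms(1), of w u] by simp
  also have "\<dots> = (\<Prod>t\<in>T. if t = p then w t else 1)" by (rule prod.cong) (auto simp: u_def)
  also have "\<dots> = w p" using assms by simp
  finally show ?thesis .
qed

text \<open>The set of records is a function of the codeword, so the expected length is at least its
  entropy, by Gibbs' inequality against the Kraft weights. Of the entropy only the contribution of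
  the records that occur is kept, which avoids logarithms of \<open>1 - 1 / k p\<close>: that number
  is 0 at the start of a chain.\<close>

lemma expected_effective_entropy_ge:
  fixes g :: "nat \<times> nat \<Rightarrow> 'g" and r :: "nat \<times> nat \<Rightarrow> nat" and m n :: nat
  defines "P \<equiv> positions m n"
  defines "k \<equiv> \<lambda>p. real (card (preds g r P p) + 1)"
  assumes rank: "\<And>p q. p \<in> P \<Longrightarrow> q \<in> P \<Longrightarrow> q \<noteq> p \<Longrightarrow> g q = g p \<Longrightarrow> r q \<noteq> r p"
    and query: "\<And>p. p \<in> P \<Longrightarrow> insert p (preds g r P p) \<in> Q"
  shows "ennreal (\<Sum>p\<in>P. log 2 (k p) / k p) \<le> expected_effective_entropy m n Q"
  unfolding expected_effective_entropy_def
proof (rule INF_greatest)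
  fix enc assume enc: "enc \<in> encodings m n Q"
  define M where "M = random_array m n"
  interpret prob_space M unfolding M_def by (rule prob_space_random_array)
  have spM: "space M = arrays m n" by (simp add: M_def space_random_array)
  have Meq: "M = PiM P (\<lambda>_. U01)" by (simp add: M_def random_array_eq P_def)
  have finP: "finite P" by (simp add: P_def)
  obtain dec where dec: "\<And>A q. A \<in> arrays m n \<Longrightarrow> q \<in> Q \<Longrightarrow> dec (enc A) q = RMQ A q"
    using enc by (auto simp: encodings_def)
  \<comment> \<open>Without ties the answer to the chain up to \<open>p\<close> is \<open>p\<close>
    exactly if \<open>p\<close> is a record; with ties this would depend on the choice
    operator.\<close>
  define X where "X = {A \<in> arrays m n. inj_on A P}"
  define Y where "Y A = {p \<in> P. is_record g r P A p}" for A
  define Ys where "Ys = Y ` X"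
  have YP: "Y A \<subseteq> P" for A by (auto simp: Y_def)
  have finYs: "finite Ys" by (rule finite_subset[of _ "Pow P"]) (use finP YP in \<open>auto simp: Ys_def\<close>)
  have YsP: "Ys \<subseteq> Pow P" using YP by (auto simp: Ys_def)
  have k1: "1 \<le> k p" for p by (simp add: k_def)
  have k0: "0 < k p" and inv1: "1 / k p \<le> 1" for p using k1[of p] by simp_all
  define W where "W y = (\<Prod>p\<in>y. 1 / k p) * (\<Prod>p\<in>P - y. 1 - 1 / k p)" for y
  have Ysets: "{A \<in> space M. Y A = y} \<in> sets M" for y
  proof -
    have rec: "{A \<in> space M. is_record g r P A p} \<in> sets M" if "p \<in> P" for p
      unfolding Meq by (rule is_record_sets[OF finP that])
    have "{A \<in> space M. is_record g r P A p \<longleftrightarrow> p \<in> y} \<in> sets M" if "p \<in> P" for p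
      using rec[OF that] sets.sets_Collect_neg[OF rec[OF that]] by (cases "p \<in> y") simp_all
    then have "{A \<in> space M. \<forall>p\<in>P. is_record g r P A p \<longleftrightarrow> p \<in> y} \<in> sets M"
      by (rule sets.sets_Collect_finite_All[OF _ finP])
    moreover have "{A \<in> space M. Y A = y} =
        (if y \<subseteq> P then {A \<in> space M. \<forall>p\<in>P. is_record g r P A p \<longleftrightarrow> p \<in> y} else {})"
      by (auto simp: Y_def)
    ultimately show ?thesis by simp
  qed
  have probY: "prob {A \<in> space M. Y A = y} = W y" if "y \<subseteq> P" for y
  proof -
    have "{A \<in> space M. Y A = y} =
        {A \<in> space M. (\<forall>p\<in>y. is_record g r P A p) \<and> (\<forall>p\<in>P - y. \<not> is_record g r P A p)}"
      using that by (auto simp: Y_def)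
    moreover have "prob {A \<in> space M. (\<forall>p\<in>y. is_record g r P A p) \<and> (\<forall>p\<in>P - y. \<not> is_record g r P A p)} = W y"
      unfolding Meq W_def k_def
      by (rule prob_record_pattern[OF finP that Diff_subset]) (use rank that in blast)+
    ultimately show ?thesis by simp
  qed
  have AEX: "AE A in M. A \<in> X"
  proof -
    have "AE A in M. inj_on A P" unfolding Meq by (rule AE_inj_on[OF finP])
    moreover have "AE A in M. A \<in> space M" by simp
    ultimately show ?thesis by eventually_elim (simp add: X_def spM)
  qed
  \<comment> \<open>Unrealised patterns have weight 0, so sums over \<open>Ys\<close> extend to
    \<open>Pow P\<close>, where the Bernoulli identities apply.\<close>
  have W0: "W y = 0" if "y \<in> Pow P - Ys" for y
  proof -
    have "AE A in M. Y A \<noteq> y" using AEX by eventually_elim (use that in \<open>auto simp: Ys_def\<close>)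
    then have "prob {A \<in> space M. Y A = y} = 0" using Ysets[of y] by (subst prob_eq_0) auto
    then show ?thesis using probY that by auto
  qed
  \<comment> \<open>One shortest codeword per record pattern: a finite subcode to which Kraft's
    inequality applies, and a pointwise lower bound for the length of \<open>enc\<close> on
    \<open>X\<close>.\<close>
  have "\<exists>A. (A \<in> X \<and> Y A = y) \<and> (\<forall>A'. A' \<in> X \<and> Y A' = y \<longrightarrow> length (enc A) \<le> length (enc A'))" if "y \<in> Ys" for y
  proof -
    from that obtain A where "A \<in> X \<and> Y A = y" by (auto simp: Ys_def)
    then show ?thesis
      by (rule ex_has_least_nat[of "\<lambda>A. A \<in> X \<and> Y A = y" _ "\<lambda>A. length (enc A)"])
  qed
  then obtain a where a: "\<And>y. y \<in> Ys \<Longrightarrow> a y \<in> X" "\<And>y. y \<in> Ys \<Longrightarrow> Y (a y) = y"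
    "\<And>y A. y \<in> Ys \<Longrightarrow> A \<in> X \<Longrightarrow> Y A = y \<Longrightarrow> length (enc (a y)) \<le> length (enc A)"
    by metis
  define l where "l y = length (enc (a y))" for y
  have Y_dec: "Y A = {p \<in> P. dec (enc A) (insert p (preds g r P p)) = p}" if "A \<in> X" for A
  proof -
    have "is_record g r P A p \<longleftrightarrow> dec (enc A) (insert p (preds g r P p)) = p" if p: "p \<in> P" for p
    proof -
      have "p \<notin> preds g r P p" by (simp add: preds_def)
      moreover have "insert p (preds g r P p) \<subseteq> P" using p by (auto simp: preds_def)
      moreover from this have "finite (insert p (preds g r P p))" "inj_on A (insert p (preds g r P p))"
        using finite_subset[OF _ finP] inj_on_subset[of A P "insert p (preds g r P p)"] \<open>A \<in> X\<close>
        unfolding X_def by blast+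
      ultimately have "RMQ A (insert p (preds g r P p)) = p \<longleftrightarrow> is_record g r P A p"
        by (subst RMQ_eq_iff) (simp_all add: is_record_def)
      then show ?thesis using dec[OF _ query[OF p], of A] \<open>A \<in> X\<close> by (simp add: X_def)
    qed
    then show ?thesis by (auto simp: Y_def)
  qed
  have kraft: "(\<Sum>y\<in>Ys. (1/2::real) ^ l y) \<le> 1"
  proof -
    have inj: "inj_on (\<lambda>y. enc (a y)) Ys"
    proof (rule inj_onI)
      fix y y' assume y: "y \<in> Ys" "y' \<in> Ys" "enc (a y) = enc (a y')"
      then have "Y (a y) = Y (a y')" using Y_dec[OF a(1)[OF y(1)]] Y_dec[OF a(1)[OF y(2)]] by simp
      then show "y = y'" using a(2) y by simp
    qed
    have "uniquely_decodable (enc ` arrays m n)" using enc by (simp add: encodings_def)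
    moreover have "(\<lambda>y. enc (a y)) ` Ys \<subseteq> enc ` arrays m n" using a(1) by (auto simp: X_def)
    ultimately have "uniquely_decodable ((\<lambda>y. enc (a y)) ` Ys)"
      unfolding uniquely_decodable_def by (rule inj_on_subset[OF _ lists_mono])
    then have "(\<Sum>c\<in>(\<lambda>y. enc (a y)) ` Ys. (1/2::real) ^ length c) \<le> 1"
      using finYs by (intro kraft_mcmillan) auto
    then show ?thesis by (simp add: sum.reindex[OF inj] l_def)
  qed
  define h where "h y = (\<Sum>p\<in>P. if p \<in> y then log 2 (k p) else 0)" for y
  have W_nonneg: "0 \<le> W y" for y
    unfolding W_def using k1 by (intro mult_nonneg_nonneg prod_nonneg) (auto simp: inv1 less_imp_le[OF k0])
  \<comment> \<open>Gibbs' inequality term by term, from \<open>ln z \<le> z - 1\<close> with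
    \<open>z = (1/2) ^ l y / W y\<close>. Summed up, the corrections become one minus the Kraft sum,
    divided by \<open>ln 2\<close>, which is nonnegative.\<close>
  have gibbs: "W y * h y + (W y - (1/2) ^ l y) / ln 2 \<le> W y * l y" if "y \<in> Ys" for y
  proof (cases "W y = 0")
    case True
    then show ?thesis by simp
  next
    case False
    with W_nonneg[of y] have Wpos: "0 < W y" by simp
    have yP: "y \<subseteq> P" using that YP by (auto simp: Ys_def)
    have fin: "finite y" "finite (P - y)" using finP finite_subset[OF yP] by auto
    have pr: "0 < (\<Prod>p\<in>y. 1 / k p)" using k0 by (intro prod_pos) simp
    have ne: "1 - 1 / k p \<noteq> 0" if "p \<in> P - y" for p
    proof
      assume "1 - 1 / k p = 0"
      then have "(\<Prod>p\<in>P - y. 1 - 1 / k p) = 0" using fin(2) that by (intro prod_zero) auto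
      with False show False by (simp add: W_def)
    qed
    have "(\<Prod>p\<in>P - y. 1 - 1 / k p) \<le> 1" by (intro prod_le_1) (auto simp: inv1 less_imp_le[OF k0])
    then have "W y \<le> (\<Prod>p\<in>y. 1 / k p)" unfolding W_def using pr by (simp add: mult_left_le)
    then have "log 2 (W y) \<le> log 2 (\<Prod>p\<in>y. 1 / k p)" using Wpos by simp
    also have "\<dots> = (\<Sum>p\<in>y. log 2 (1 / k p))"
      unfolding log_def sum_divide_distrib[symmetric] by (subst ln_prod) (simp_all add: fin k0 less_imp_neq[OF k0, symmetric])
    also have "\<dots> = - (\<Sum>p\<in>y. log 2 (k p))" by (simp add: log_divide sum_negf less_imp_neq[OF k0, symmetric])
    also have "(\<Sum>p\<in>y. log 2 (k p)) = h y"
      unfolding h_def using finP yP by (simp add: sum.inter_restrict[symmetric] Int_absorb1)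
    finally have hW: "h y \<le> - log 2 (W y)" by simp
    define z where "z = (1/2) ^ l y / W y"
    have z: "0 < z" using Wpos by (simp add: z_def)
    have "log 2 z = - real (l y) - log 2 (W y)"
      using Wpos by (simp add: z_def log_divide log_nat_power)
    moreover have "log 2 z \<le> (z - 1) / ln 2"
      unfolding log_def using ln_le_minus_one[OF z] by (simp add: divide_right_mono)
    ultimately have "h y - (z - 1) / ln 2 \<le> l y" using hW by simp
    then have "W y * (h y - (z - 1) / ln 2) \<le> W y * l y" using Wpos by (intro mult_left_mono) auto
    moreover have "W y * z = (1/2) ^ l y" using Wpos by (simp add: z_def)
    ultimately show ?thesis by (simp add: algebra_simps diff_divide_distrib)
  qed
  have PowYs: "(\<Sum>y\<in>Ys. W y * f y) = (\<Sum>y\<in>Pow P. W y * f y)" for f :: "_ \<Rightarrow> real"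
  proof (rule sum.mono_neutral_left[OF _ YsP])
    show "finite (Pow P)" using finP by simp
    show "\<forall>y\<in>Pow P - Ys. W y * f y = 0" using W0 by simp
  qed
  have sumW: "(\<Sum>y\<in>Ys. W y) = 1"
    using PowYs[of "\<lambda>_. 1"] sum_prod_Bernoulli[OF finP, of "\<lambda>p. 1 / k p"] by (simp add: W_def)
  have sumh: "(\<Sum>y\<in>Ys. W y * h y) = (\<Sum>p\<in>P. log 2 (k p) / k p)"
  proof -
    have "(\<Sum>y\<in>Ys. W y * h y) = (\<Sum>y\<in>Pow P. W y * h y)" by (rule PowYs)
    also have "\<dots> = (\<Sum>y\<in>Pow P. \<Sum>p\<in>P. log 2 (k p) * (if p \<in> y then W y else 0))"
      unfolding h_def sum_distrib_left by (intro sum.cong) auto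
    also have "\<dots> = (\<Sum>p\<in>P. log 2 (k p) * (\<Sum>y\<in>Pow P. if p \<in> y then W y else 0))"
      by (subst sum.swap) (simp add: sum_distrib_left)
    also have "\<dots> = (\<Sum>p\<in>P. log 2 (k p) * (1 / k p))"
      unfolding W_def using sum_prod_Bernoulli_mem[OF finP, of _ "\<lambda>p. 1 / k p"] by (intro sum.cong) auto
    finally show ?thesis by simp
  qed
  have "(\<Sum>p\<in>P. log 2 (k p) / k p) \<le> (\<Sum>y\<in>Ys. W y * l y)"
  proof -
    have "(\<Sum>y\<in>Ys. W y * h y + (W y - (1/2) ^ l y) / ln 2) \<le> (\<Sum>y\<in>Ys. W y * l y)"
      by (rule sum_mono) (rule gibbs)
    moreover have "(\<Sum>y\<in>Ys. W y * h y + (W y - (1/2) ^ l y) / ln 2) =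
        (\<Sum>p\<in>P. log 2 (k p) / k p) + (1 - (\<Sum>y\<in>Ys. (1/2) ^ l y)) / ln 2"
      by (simp add: sum.distrib sumh sum_divide_distrib[symmetric] sum_subtractf sumW)
    moreover have "0 \<le> (1 - (\<Sum>y\<in>Ys. (1/2::real) ^ l y)) / ln 2" using kraft by simp
    ultimately show ?thesis by linarith
  qed
  then have "ennreal (\<Sum>p\<in>P. log 2 (k p) / k p) \<le> ennreal (\<Sum>y\<in>Ys. W y * l y)"
    by (rule ennreal_leI)
  also have "\<dots> = (\<Sum>y\<in>Ys. ennreal (l y) * emeasure M {A \<in> space M. Y A = y})"
  proof -
    have "ennreal (W y * l y) = ennreal (l y) * emeasure M {A \<in> space M. Y A = y}" if "y \<in> Ys" for y
      using that YP probY[of y] W_nonneg[of y]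
      by (auto simp: Ys_def emeasure_eq_measure ennreal_mult[symmetric] mult.commute)
    then have "(\<Sum>y\<in>Ys. ennreal (W y * l y)) = (\<Sum>y\<in>Ys. ennreal (l y) * emeasure M {A \<in> space M. Y A = y})"
      by (rule sum.cong[OF refl])
    then show ?thesis using W_nonneg by (simp add: sum_ennreal)
  qed
  also have "\<dots> = (\<integral>\<^sup>+ A. (\<Sum>y\<in>Ys. ennreal (l y) * indicator {A \<in> space M. Y A = y} A) \<partial>M)"
    using Ysets by (subst nn_integral_sum) (auto simp: nn_integral_cmult_indicator)
  also have "\<dots> \<le> (\<integral>\<^sup>+ A. of_nat (length (enc A)) \<partial>M)"
  proof (rule nn_integral_mono_AE)
    show "AE A in M. (\<Sum>y\<in>Ys. ennreal (l y) * indicator {A \<in> space M. Y A = y} A) \<le> of_nat (length (enc A))"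
      using AEX
    proof eventually_elim
      case (elim A)
      then have A: "A \<in> space M" "Y A \<in> Ys" by (auto simp: X_def spM Ys_def)
      have "(\<Sum>y\<in>Ys. ennreal (l y) * indicator {A \<in> space M. Y A = y} A) = (\<Sum>y\<in>Ys. if y = Y A then ennreal (l y) else 0)"
        by (rule sum.cong) (use A in \<open>auto simp: indicator_def\<close>)
      also have "\<dots> = ennreal (l (Y A))" using A finYs by simp
      also have "\<dots> \<le> ennreal (length (enc A))"
        using a(3)[OF A(2) elim refl] by (intro ennreal_leI) (simp add: l_def)
      finally show ?case by (simp add: ennreal_of_nat_eq_real_of_nat)
    qed
  qed
  finally show "ennreal (\<Sum>p\<in>P. log 2 (k p) / k p) \<le> expected_bits m n enc"
    by (simp add: expected_bits_def M_def)
qed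

section \<open>An upper bound from minimal ranges\<close>

text \<open>
  Think of \<open>G x y\<close> as the smallest query range containing \<open>x\<close> and \<open>y\<close>. A position \<open>x\<close> is the answer
  of a query unless the range contains a larger entry, and then one for which \<open>G x y\<close> is minimal;
  so it suffices to store the pairs for which \<open>y\<close> is the only entry of \<open>G x y\<close> larger than \<open>x\<close>.
  The diagonal \<open>G x x\<close> collects the entries that are in every range containing \<open>x\<close>.
\<close>
lemma expected_effective_entropy_le_hull:
  fixes G :: "nat \<times> nat \<Rightarrow> nat \<times> nat \<Rightarrow> (nat \<times> nat) set" and \<kappa> :: "nat \<times> nat \<Rightarrow> nat \<times> nat \<Rightarrow> real"
  defines "T m n \<equiv> {(x, y) \<in> positions m n \<times> positions m n. y = x \<or> y \<notin> G x x}"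
  assumes hull: "\<And>x y. (x, y) \<in> T m n \<Longrightarrow> G x y \<subseteq> positions m n \<and> x \<in> G x y \<and> y \<in> G x y"
    and closed: "\<And>q x y. q \<in> Q \<Longrightarrow> (x, y) \<in> T m n \<Longrightarrow> x \<in> q \<Longrightarrow> y \<in> q \<Longrightarrow> G x y \<subseteq> q"
    and less: "\<And>x y z. (x, y) \<in> T m n \<Longrightarrow> (x, z) \<in> T m n \<Longrightarrow> z \<in> G x y - {x, y} \<Longrightarrow> G x z \<subset> G x y"
    and \<kappa>: "\<And>x y. (x, y) \<in> T m n \<Longrightarrow> 1 \<le> \<kappa> x y"
    and \<kappa>_diag: "\<And>x. x \<in> positions m n \<Longrightarrow> \<kappa> x x \<le> 8 * real (card (G x x))"
    and \<kappa>_off: "\<And>x y. (x, y) \<in> T m n \<Longrightarrow> x \<noteq> y \<Longrightarrow> \<kappa> x y \<le> 8 * (real (card (G x y)) * (real (card (G x y)) - 1))"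
    and Q: "\<And>q. q \<in> Q \<Longrightarrow> q \<subseteq> positions m n \<and> q \<noteq> {}"
  shows "expected_effective_entropy m n Q \<le>
    ennreal (2 + (\<Sum>(x, y)\<in>T m n. 10 * (1 + log 2 (\<kappa> x y)) / \<kappa> x y))"
proof -
  define P where "P = positions m n"
  \<comment> \<open>On the diagonal the second conjunct is vacuous and the event says that
    \<open>x\<close> is the largest entry of \<open>G x x\<close>.\<close>
  define E where "E = (\<lambda>(x, y) A. (\<forall>z\<in>G x y - {x, y}. A z < (A x :: real)) \<and> (x \<noteq> y \<longrightarrow> A x < A y))"
  have finP: "finite P" by (simp add: P_def)
  have finT: "finite (T m n)" by (rule finite_subset[of _ "P \<times> P"]) (auto simp: T_def P_def)
  have TP: "x \<in> P" "y \<in> P" if "(x, y) \<in> T m n" for x y using that by (auto simp: T_def P_def)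
  have diagT: "(x, x) \<in> T m n" if "x \<in> P" for x using that by (simp add: T_def P_def)
  have "expected_effective_entropy m n Q \<le>
    ennreal (2 + (\<Sum>t\<in>T m n. 10 * (1 + log 2 (case_prod \<kappa> t)) / case_prod \<kappa> t))"
  proof (rule expected_effective_entropy_le[where E = E and T = "T m n" and \<kappa> = "case_prod \<kappa>", OF finT])
    fix t assume t: "t \<in> T m n"
    obtain x y where xy: "t = (x, y)" by (cases t)
    have T: "(x, y) \<in> T m n" using t xy by simp
    show "1 \<le> case_prod \<kappa> t" using \<kappa>[OF T] xy by simp
    have lt: "{A \<in> space (random_array m n). A u < A v} \<in> sets (random_array m n)" if "u \<in> P" "v \<in> P" for u v
      unfolding random_array_eq using that by (intro borel_measurable_less measurable_component_U01) (simp_all add: P_def)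
    have 1: "{A \<in> space (random_array m n). \<forall>z\<in>G x y - {x, y}. A z < A x} \<in> sets (random_array m n)"
    proof (rule sets.sets_Collect_finite_All)
      show "finite (G x y - {x, y})" using hull[OF T] finite_subset[OF _ finP] by (auto simp: P_def)
      show "{A \<in> space (random_array m n). A z < A x} \<in> sets (random_array m n)" if "z \<in> G x y - {x, y}" for z
        by (rule lt) (use that hull[OF T] TP[OF T] in \<open>auto simp: P_def\<close>)
    qed
    have 2: "{A \<in> space (random_array m n). x \<noteq> y \<longrightarrow> A x < A y} \<in> sets (random_array m n)"
      using lt[OF TP[OF T]] by (cases "x = y") simp_all
    show "{A \<in> arrays m n. E t A} \<in> sets (random_array m n)"
      using sets.sets_Collect_conj[OF 2 1] by (simp add: xy E_def space_random_array)
    show "measure (random_array m n) {A \<in> arrays m n. E t A} \<le> 8 / case_prod \<kappa> t"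
    proof (cases "x = y")
      case True
      have "measure (random_array m n) {A \<in> arrays m n. E t A} = 1 / real (card (G x x))"
        unfolding space_random_array[symmetric] random_array_eq
        using prob_max[OF finite_positions, of "G x x" m n x] hull[OF T] True by (simp add: xy E_def)
      moreover have "card (G x x) > 0"
        using hull[OF T] True finite_subset[of "G x x" P] finP
        by (auto simp: card_gt_0_iff P_def)
      then have "1 / real (card (G x x)) \<le> 8 / \<kappa> x x"
        using \<kappa>_diag[of x] \<kappa>[OF T] TP[OF T] True by (simp add: field_simps P_def)
      ultimately show ?thesis using True xy by simp
    next
      case False
      define s where "s = real (card (G x y))"
      have "measure (random_array m n) {A \<in> arrays m n. E t A} = 1 / (s * (s - 1))"
        unfolding space_random_array[symmetric] random_array_eq s_def
        using prob_max_except_one[OF finite_positions, of "G x y" m n x y] hull[OF T] False by (simp add: xy E_def)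
      moreover have "0 < s * (s - 1)" using \<kappa>_off[OF T False] \<kappa>[OF T] unfolding s_def by linarith
      then have "1 / (s * (s - 1)) \<le> 8 / \<kappa> x y"
        using frac_le[of 8 8 "\<kappa> x y" "8 * (s * (s - 1))"] \<kappa>_off[OF T False, folded s_def] \<kappa>[OF T] by simp
      ultimately show ?thesis using xy by simp
    qed
  next
    fix A A' :: "nat \<times> nat \<Rightarrow> real" and q
    assume inj: "inj_on A (positions m n)" "inj_on A' (positions m n)"
      and same: "\<And>t. t \<in> T m n \<Longrightarrow> E t A \<longleftrightarrow> E t A'" and q: "q \<in> Q"
    have qP: "q \<subseteq> P" and finq: "finite q" and qne: "q \<noteq> {}"
      using Q[OF q] finite_subset[OF _ finP] by (auto simp: P_def)
    \<comment> \<open>The right-hand side involves \<open>B\<close> only through the stored events;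
      applied to the answer of \<open>A\<close>, it carries over to \<open>A'\<close>.\<close>
    have char: "RMQ B q = x \<longleftrightarrow> E (x, x) B \<and> (\<forall>y\<in>q. (x, y) \<in> T m n \<longrightarrow> x \<noteq> y \<longrightarrow> \<not> E (x, y) B)"
      if B: "inj_on B (positions m n)" and x: "x \<in> q" for B :: "nat \<times> nat \<Rightarrow> real" and x
    proof -
      have xP: "x \<in> P" using x qP by auto
      have neq: "B y \<noteq> B z" if "y \<in> P" "z \<in> P" "y \<noteq> z" for y z
        using B that by (auto simp: inj_on_def P_def)
      have "RMQ B q = x \<longleftrightarrow> (\<forall>y\<in>q - {x}. B y < B x)"
        by (rule RMQ_eq_iff[OF finq x]) (use B qP inj_on_subset in \<open>auto simp: P_def\<close>)
      also have "\<dots> \<longleftrightarrow> E (x, x) B \<and> (\<forall>y\<in>q. (x, y) \<in> T m n \<longrightarrow> x \<noteq> y \<longrightarrow> \<not> E (x, y) B)"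
      proof (intro iffI conjI ballI impI)
        assume max: "\<forall>y\<in>q - {x}. B y < B x"
        show "E (x, x) B" using max closed[OF q diagT[OF xP] x x] by (auto simp: E_def)
        show "\<not> E (x, y) B" if "y \<in> q" "x \<noteq> y" for y
        proof -
          have "B y < B x" using max that by blast
          then show ?thesis using that by (simp add: E_def)
        qed
      next
        assume Ex: "E (x, x) B \<and> (\<forall>y\<in>q. (x, y) \<in> T m n \<longrightarrow> x \<noteq> y \<longrightarrow> \<not> E (x, y) B)"
        fix y assume y: "y \<in> q - {x}"
        show "B y < B x"
        proof (rule ccontr)
          assume "\<not> B y < B x"
          then have "y \<in> q \<and> B x < B y" using neq[of x y] xP qP y by fastforce
          then obtain z where z: "z \<in> q" "B x < B z"
            and least: "\<And>u. u \<in> q \<Longrightarrow> B x < B u \<Longrightarrow> card (G x z) \<le> card (G x u)"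
            using ex_has_least_nat[of "\<lambda>u. u \<in> q \<and> B x < B u" y "\<lambda>u. card (G x u)"] by auto
          \<comment> \<open>By the diagonal event no larger entry lies in \<open>G x x\<close>, so
            every larger entry of \<open>q\<close> forms a pair in \<open>T m n\<close> with
            \<open>x\<close>.\<close>
          have out: "(x, u) \<in> T m n" if "u \<in> q" "B x < B u" for u
          proof -
            have "u \<notin> G x x"
            proof
              assume "u \<in> G x x"
              moreover have "u \<noteq> x" using that by auto
              ultimately have "B u < B x" using Ex by (simp add: E_def)
              then show False using that by simp
            qed
            then show ?thesis using xP that qP by (auto simp: T_def P_def)
          qed
          have Gq: "G x z \<subseteq> q" by (rule closed[OF q out[OF z] x z(1)])
          have finG: "finite (G x z)" by (rule finite_subset[OF Gq finq])
          have "B u < B x" if u: "u \<in> G x z - {x, z}" for u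
          proof (rule ccontr)
            assume "\<not> B u < B x"
            moreover have uq: "u \<in> q" using u Gq by auto
            ultimately have gt: "B x < B u" using neq[of x u] xP qP u by fastforce
            have "G x u \<subset> G x z" by (rule less[OF out[OF z] out[OF uq gt] u])
            then have "card (G x u) < card (G x z)" by (rule psubset_card_mono[OF finG])
            with least[OF uq gt] show False by simp
          qed
          then have "E (x, z) B" using z by (simp add: E_def)
          moreover have "x \<noteq> z" using z by auto
          ultimately show False using Ex z out[OF z] by blast
        qed
      qed
      finally show ?thesis .
    qed
    have mem: "RMQ A q \<in> q"
      using finq qne by (rule RMQ_is_max)
    have xP: "RMQ A q \<in> P" using mem qP by auto
    have "E (RMQ A q, RMQ A q) A \<and> (\<forall>y\<in>q. (RMQ A q, y) \<in> T m n \<longrightarrow> RMQ A q \<noteq> y \<longrightarrow> \<not> E (RMQ A q, y) A)"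
      using char[OF inj(1) mem] by simp
    then have "E (RMQ A q, RMQ A q) A' \<and> (\<forall>y\<in>q. (RMQ A q, y) \<in> T m n \<longrightarrow> RMQ A q \<noteq> y \<longrightarrow> \<not> E (RMQ A q, y) A')"
      using same diagT[OF xP] by blast
    then show "RMQ A q = RMQ A' q"
      using char[OF inj(2) mem] by simp
  qed (use Q in auto)
  then show ?thesis by (simp add: case_prod_unfold)
qed

section \<open>Elementary sums\<close>

text \<open>Up to a factor 10, the cost of a pair with \<open>\<kappa>\<close> equal to the square
  of \<open>t\<close>, where \<open>t\<close> measures its range.\<close>

definition \<phi> :: "nat \<Rightarrow> real" where
  "\<phi> t = (1 + 2 * log 2 t) / (real t)\<^sup>2"

lemma \<phi>_nonneg: "1 \<le> t \<Longrightarrow> 0 \<le> \<phi> t"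
  by (simp add: \<phi>_def)

text \<open>Turns the cost of a rectangle into a product over its sides, so that the double sums
  factor. The numerators satisfy \<open>1 + a + b \<le> (1 + a) * (1 + b)\<close>.\<close>

lemma \<phi>_mult_le:
  assumes "1 \<le> s" "1 \<le> t"
  shows "\<phi> (s * t) \<le> \<phi> s * \<phi> t"
proof -
  have l: "0 \<le> log 2 (real s)" "0 \<le> log 2 (real t)" using assms by simp_all
  have "1 + 2 * log 2 (real (s * t)) = 1 + 2 * log 2 s + 2 * log 2 t"
    using assms by (simp add: log_mult)
  also have "\<dots> \<le> (1 + 2 * log 2 s) * (1 + 2 * log 2 t)"
    using mult_nonneg_nonneg[OF l] by (simp add: algebra_simps)
  finally have "\<phi> (s * t) \<le> (1 + 2 * log 2 s) * (1 + 2 * log 2 t) / (real (s * t))\<^sup>2"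
    unfolding \<phi>_def by (rule divide_right_mono) simp
  then show ?thesis by (simp add: \<phi>_def power_mult_distrib)
qed

text \<open>The logarithm is absorbed by a square root, which leaves the convergent series of
  \<open>t powr (- 3 / 2)\<close>.\<close>

lemma sum_\<phi>_bounded: "\<exists>K>0. \<forall>N. (\<Sum>t=1..N. \<phi> t) \<le> K"
proof -
  let ?f = "\<lambda>t. real t powr (- 3 / 2)"
  have sm: "summable ?f" using summable_real_powr_iff[of "- 3 / 2"] by simp
  have le: "\<phi> t \<le> 7 * ?f t" if "1 \<le> t" for t
  proof -
    have t: "1 \<le> real t" using that by simp
    have "ln (real t) = 2 * ln (sqrt t)" using t by (simp add: ln_sqrt)
    also have "\<dots> \<le> 2 * sqrt t" using ln_le_minus_one[of "sqrt t"] t by simp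
    finally have "ln (real t) \<le> 2 * sqrt t" .
    also have "\<dots> \<le> 3 * sqrt t * ln 2"
      using mult_left_mono[OF ln2_ge_two_thirds, of "3 * sqrt t"] t by simp
    finally have "log 2 t \<le> 3 * sqrt t" by (simp add: log_def field_simps)
    moreover have "1 \<le> sqrt t" using t by simp
    ultimately have "1 + 2 * log 2 t \<le> 7 * sqrt t" by linarith
    then have "\<phi> t \<le> 7 * sqrt t / (real t)\<^sup>2" unfolding \<phi>_def by (rule divide_right_mono) simp
    then have "\<phi> t \<le> 7 * (sqrt t / (real t)\<^sup>2)" by simp
    also have "sqrt t / (real t)\<^sup>2 = ?f t"
    proof -
      have "sqrt t / (real t)\<^sup>2 = real t powr (1/2) / real t powr 2"
        using t by (simp add: powr_half_sqrt powr_numeral)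
      also have "\<dots> = real t powr (1/2 - 2)" by (rule powr_diff[symmetric])
      also have "1/2 - 2 = (- 3 / 2 :: real)" by simp
      finally show ?thesis .
    qed
    finally show ?thesis .
  qed
  have "(\<Sum>t=1..N. \<phi> t) \<le> 7 * suminf ?f + 1" for N
  proof -
    have "(\<Sum>t=1..N. \<phi> t) \<le> (\<Sum>t=1..N. 7 * ?f t)" by (rule sum_mono) (use le in auto)
    also have "\<dots> = 7 * (\<Sum>t=1..N. ?f t)" by (simp add: sum_distrib_left)
    also have "(\<Sum>t=1..N. ?f t) \<le> suminf ?f" by (rule sum_le_suminf[OF sm]) auto
    finally show ?thesis by simp
  qed
  moreover have "0 \<le> suminf ?f" by (rule suminf_nonneg[OF sm]) simp
  ultimately show ?thesis by (intro exI[of _ "7 * suminf ?f + 1"]) (auto simp: add_nonneg_pos)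
qed

text \<open>This is the distance of \<open>i\<close> and \<open>a\<close> plus 1, the side length of
  a bounding box.\<close>

definition extent :: "nat \<Rightarrow> nat \<Rightarrow> nat" where
  "extent i a = card {min i a..max i a}"

lemma extent_pos: "1 \<le> extent i a"
  by (simp add: extent_def)

text \<open>Each extent is attained at most once on either side of \<open>i\<close>.\<close>

lemma sum_extent_le:
  assumes f: "\<And>t. 1 \<le> t \<Longrightarrow> 0 \<le> (f t :: real)" and i: "i \<in> {1..m}"
  shows "(\<Sum>a=1..m. f (extent i a)) \<le> 2 * (\<Sum>t=1..m. f t)"
proof -
  have "(\<Sum>a=1..m. f (extent i a)) = (\<Sum>a\<in>{1..i} \<union> {i<..m}. f (extent i a))"
    by (rule sum.cong) (use i in auto)
  also have "\<dots> = (\<Sum>a=1..i. f (extent i a)) + (\<Sum>a\<in>{i<..m}. f (extent i a))"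
    by (rule sum.union_disjoint) auto
  also have "(\<Sum>a=1..i. f (extent i a)) = (\<Sum>t=1..i. f t)"
    by (rule sum.reindex_bij_witness[of _ "\<lambda>t. i + 1 - t" "\<lambda>a. i + 1 - a"]) (auto simp: extent_def max_def min_def intro!: arg_cong[where f = f])
  also have "(\<Sum>t=1..i. f t) \<le> (\<Sum>t=1..m. f t)"
    by (rule sum_mono2) (use i f in auto)
  \<comment> \<open>Extent 1 is missing here, since \<open>a = i\<close> has been counted on the
    other side.\<close>
  also have "(\<Sum>a\<in>{i<..m}. f (extent i a)) = (\<Sum>t=2..m + 1 - i. f t)"
    by (rule sum.reindex_bij_witness[of _ "\<lambda>t. t + i - 1" "\<lambda>a. a + 1 - i"]) (auto simp: extent_def max_def min_def intro!: arg_cong[where f = f])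
  also have "(\<Sum>t=2..m + 1 - i. f t) \<le> (\<Sum>t=1..m. f t)"
    by (rule sum_mono2) (use i f in auto)
  finally show ?thesis by simp
qed

section \<open>Two-sided estimates for the sum of (log i)/i\<close>

lemma log2_ge_1: "2 \<le> m \<Longrightarrow> 1 \<le> log 2 (real m)"
  using log_mono[of 2 2 "real m"] by simp

text \<open>Every numerator is at most \<open>3 * log 2 m\<close> and the harmonic sum at most
  \<open>2 * log 2 m\<close>; both absorb a constant 1 into \<open>log 2 m\<close>, which is at
  least 1 because \<open>2 \<le> m\<close>.\<close>

lemma sum_log_div_le:
  assumes "2 \<le> m"
  shows "(\<Sum>i=1..m. (1 + 2 * log 2 (real i)) / i) \<le> 6 * (log 2 m)\<^sup>2"
proof -
  have harm: "(\<Sum>i=1..m. 1 / real i) \<le> 1 + ln m" if "1 \<le> m" for m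
    using that
  proof (induction m rule: dec_induct)
    case (step k)
    have "ln (real k / (real k + 1)) \<le> real k / (real k + 1) - 1"
      by (rule ln_le_minus_one) (use step in simp)
    moreover have "real k / (real k + 1) - 1 = - (1 / real (Suc k))"
      by (simp add: field_simps)
    moreover have "ln (real k / (real k + 1)) = ln k - ln (Suc k)"
      using step by (simp add: ln_div add.commute)
    ultimately have "1 / real (Suc k) \<le> ln (Suc k) - ln k" by linarith
    then show ?case using step by simp
  qed simp
  have L: "1 \<le> log 2 m" by (rule log2_ge_1[OF assms])
  have "ln (real m) \<le> log 2 m"
  proof -
    have "ln (2::real) \<le> 1" using ln_le_minus_one[of 2] by simp
    then have "ln (real m) * ln 2 \<le> ln (real m) * 1" using assms by (intro mult_left_mono) auto
    then show ?thesis by (simp add: log_def field_simps)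
  qed
  moreover have "(\<Sum>i=1..m. 1 / real i) \<le> 1 + ln m" by (rule harm) (use assms in simp)
  ultimately have H: "(\<Sum>i=1..m. 1 / real i) \<le> 2 * log 2 m" using L by linarith
  have "(\<Sum>i=1..m. (1 + 2 * log 2 (real i)) / i) \<le> (\<Sum>i=1..m. 3 * log 2 m * (1 / i))"
  proof (rule sum_mono)
    fix i assume i: "i \<in> {1..m}"
    then have "log 2 (real i) \<le> log 2 m" by simp
    then have "1 + 2 * log 2 (real i) \<le> 3 * log 2 m" using L by linarith
    then have "(1 + 2 * log 2 (real i)) / i \<le> 3 * log 2 m / i" by (rule divide_right_mono) simp
    then show "(1 + 2 * log 2 (real i)) / i \<le> 3 * log 2 m * (1 / i)" by simp
  qed
  also have "\<dots> = 3 * log 2 m * (\<Sum>i=1..m. 1 / i)" by (simp add: sum_distrib_left)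
  also have "\<dots> \<le> 3 * log 2 m * (2 * log 2 m)" using L by (intro mult_left_mono[OF H]) simp
  finally show ?thesis by (simp add: power2_eq_square)
qed

text \<open>A discrete integration of \<open>log x / x\<close>: with
  \<open>v = log 2 (k + 1)\<close>, the squared logarithm grows by at most \<open>2 * v\<close>
  times the increment of the logarithm, and that increment is at most \<open>3 / (k + 1)\<close>;
  hence the 6.\<close>

lemma sum_log_div_ge:
  assumes "1 \<le> m"
  shows "(log 2 m)\<^sup>2 / 6 \<le> (\<Sum>i=1..m. log 2 (real i) / i)"
  using assms
proof (induction m rule: dec_induct)
  case (step k)
  define u v where "u = log 2 (real k)" and "v = log 2 (real (Suc k))"
  have k: "1 \<le> real k" using step by simp
  have uv: "0 \<le> u" "u \<le> v" using k by (simp_all add: u_def v_def)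
  have "v - u = ln ((real k + 1) / k) / ln 2"
    using k by (simp add: u_def v_def log_def ln_div diff_divide_distrib add.commute)
  also have "ln ((real k + 1) / k) \<le> (real k + 1) / k - 1"
    by (rule ln_le_minus_one) (use k in simp)
  also have "(real k + 1) / k - 1 = 1 / k" using k by (simp add: field_simps)
  finally have "v - u \<le> 1 / k / ln 2" by (simp add: divide_right_mono)
  also have "\<dots> \<le> 1 / k / (2/3)" using ln2_ge_two_thirds k by (intro divide_left_mono) auto
  also have "\<dots> \<le> 3 / real (Suc k)" using k by (simp add: field_simps)
  finally have d: "v - u \<le> 3 / real (Suc k)" .
  have "v\<^sup>2 - u\<^sup>2 = (v - u) * (v + u)" by (simp add: power2_eq_square algebra_simps)
  also have "\<dots> \<le> 3 / real (Suc k) * (2 * v)"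
    using d uv by (intro mult_mono) auto
  finally have "v\<^sup>2 / 6 \<le> u\<^sup>2 / 6 + v / Suc k" by (simp add: field_simps)
  then show ?case using step by (simp add: u_def v_def)
qed simp

lemma sum_positions:
  "(\<Sum>x\<in>positions m n. f x) = (\<Sum>i=1..m. \<Sum>j=1..n. f (i, j))"
  unfolding positions_def sum.cartesian_product by (simp add: case_prod_unfold)

section \<open>Four- and three-sided queries\<close>

text \<open>\<open>G x y\<close> is the bounding box, with \<open>G x x = {x}\<close>. For fixed
  \<open>x\<close> the costs of all \<open>y\<close> are bounded by a product of a row sum and a
  column sum, each at most \<open>2 * K\<close>, so every position pays a constant.\<close>

lemma four_sided_le:
  "\<exists>C>0. \<forall>m n. 2 \<le> m \<longrightarrow> m \<le> n \<longrightarrow>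
    expected_effective_entropy m n (four_sided m n) \<le> ennreal (C * (real n * real m))"
proof -
  obtain K where K: "0 < K" "\<And>N. (\<Sum>t=1..N. \<phi> t) \<le> K" using sum_\<phi>_bounded by auto
  define G :: "nat \<times> nat \<Rightarrow> nat \<times> nat \<Rightarrow> (nat \<times> nat) set" where
    "G = (\<lambda>(i, j) (a, b). {min i a..max i a} \<times> {min j b..max j b})"
  define \<kappa> where "\<kappa> x y = (real (card (G x y)))\<^sup>2" for x y
  have cardG: "card (G (i, j) (a, b)) = extent i a * extent j b" for i j a b
    by (simp add: G_def extent_def)
  have bound: "expected_effective_entropy m n (four_sided m n) \<le> ennreal ((2 + 40 * K\<^sup>2) * (real n * real m))"
    if mn: "2 \<le> m" "m \<le> n" for m n
  proof -
    define P where "P = positions m n"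
    define T where "T = {(x, y) \<in> P \<times> P. y = x \<or> y \<notin> G x x}"
    have s1: "1 \<le> card (G x y)" for x y
      using extent_pos by (cases x; cases y) (simp add: cardG Suc_leI)
    have "expected_effective_entropy m n (four_sided m n) \<le>
      ennreal (2 + (\<Sum>(x, y)\<in>T. 10 * (1 + log 2 (\<kappa> x y)) / \<kappa> x y))"
      unfolding T_def P_def
    proof (rule expected_effective_entropy_le_hull[where G = G and \<kappa> = \<kappa>])
      fix x y assume T: "(x, y) \<in> {(x, y) \<in> positions m n \<times> positions m n. y = x \<or> y \<notin> G x x}"
      then have xy: "x \<in> positions m n" "y \<in> positions m n" by auto
      show "G x y \<subseteq> positions m n \<and> x \<in> G x y \<and> y \<in> G x y"
        using xy by (auto simp: G_def positions_def)
      show "1 \<le> \<kappa> x y" unfolding \<kappa>_def using s1[of x y] by simp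
      show "\<kappa> x y \<le> 8 * (real (card (G x y)) * (real (card (G x y)) - 1))" if "x \<noteq> y"
      proof -
        have "{x, y} \<subseteq> G x y" by (auto simp: G_def split: prod.splits)
        moreover have "finite (G x y)" by (cases x; cases y) (simp add: G_def)
        ultimately have "card {x, y} \<le> card (G x y)" by (intro card_mono)
        then have "2 \<le> real (card (G x y))" using that by simp
        \<comment> \<open>Rearranged: the square of the area \<open>s\<close> is at most
          \<open>8 * (s * (s - 1))\<close>.\<close>
        then have "0 \<le> real (card (G x y)) * (7 * real (card (G x y)) - 8)" by simp
        then show ?thesis by (simp add: \<kappa>_def power2_eq_square algebra_simps)
      qed
      show "G x y \<subseteq> q" if "q \<in> four_sided m n" "x \<in> q" "y \<in> q" for q
        using that by (auto simp: four_sided_def G_def)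
      show "G x z \<subset> G x y" if "z \<in> G x y - {x, y}" for z
      proof -
        obtain i j a b c e where xyz: "x = (i, j)" "y = (a, b)" "z = (c, e)"
          by (cases x; cases y; cases z)
        have c: "min i a \<le> c" "c \<le> max i a" and e: "min j b \<le> e" "e \<le> max j b"
          and ne: "c \<noteq> a \<or> e \<noteq> b"
          using that by (auto simp: xyz G_def)
        have "min i a \<le> min i c" "max i c \<le> max i a" "min j b \<le> min j e" "max j e \<le> max j b"
          using c e by linarith+
        then have "G x z \<subseteq> G x y" by (auto simp: xyz G_def)
        \<comment> \<open>In a coordinate where \<open>z\<close> differs from \<open>y\<close> it is
          strictly closer to \<open>x\<close>, which leaves \<open>y\<close> outside the box of
          \<open>x\<close> and \<open>z\<close>.\<close>
        moreover have "a \<notin> {min i c..max i c} \<or> b \<notin> {min j e..max j e}"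
          unfolding atLeastAtMost_iff using c e ne by linarith
        then have "y \<notin> G x z" by (auto simp: xyz G_def)
        moreover have "y \<in> G x y" by (auto simp: xyz G_def)
        ultimately show ?thesis by blast
      qed
    next
      fix x show "\<kappa> x x \<le> 8 * real (card (G x x))"
        by (cases x) (simp add: \<kappa>_def G_def)
    next
      fix q assume "q \<in> four_sided m n"
      then show "q \<subseteq> positions m n \<and> q \<noteq> {}" by (auto simp: four_sided_def positions_def)
    qed
    also have "\<dots> \<le> ennreal ((2 + 40 * K\<^sup>2) * (real n * real m))"
    proof (rule ennreal_leI)
      have cost: "10 * (1 + log 2 (\<kappa> x y)) / \<kappa> x y = 10 * \<phi> (card (G x y))" for x y
        using s1[of x y] by (simp add: \<kappa>_def \<phi>_def log_nat_power)
      have "(\<Sum>(x, y)\<in>T. 10 * (1 + log 2 (\<kappa> x y)) / \<kappa> x y) \<le> (\<Sum>(x, y)\<in>P \<times> P. 10 * \<phi> (card (G x y)))"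
        unfolding cost by (rule sum_mono2) (use \<phi>_nonneg[OF s1] in \<open>auto simp: P_def T_def\<close>)
      also have "\<dots> = (\<Sum>x\<in>P. \<Sum>y\<in>P. 10 * \<phi> (card (G x y)))"
        by (simp add: sum.cartesian_product)
      also have "\<dots> \<le> (\<Sum>x\<in>P. 40 * K\<^sup>2)"
      proof (rule sum_mono)
        fix x assume "x \<in> P"
        then obtain i j where x: "x = (i, j)" "i \<in> {1..m}" "j \<in> {1..n}" by (auto simp: P_def positions_def)
        have "(\<Sum>y\<in>P. 10 * \<phi> (card (G x y))) = 10 * (\<Sum>a=1..m. \<Sum>b=1..n. \<phi> (extent i a * extent j b))"
          unfolding P_def positions_def x(1)
          by (simp add: sum.cartesian_product sum_distrib_left cardG case_prod_unfold G_def extent_def)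
        also have "\<dots> \<le> 10 * (\<Sum>a=1..m. \<Sum>b=1..n. \<phi> (extent i a) * \<phi> (extent j b))"
          by (intro mult_left_mono sum_mono \<phi>_mult_le extent_pos) simp
        also have "\<dots> = 10 * ((\<Sum>a=1..m. \<phi> (extent i a)) * (\<Sum>b=1..n. \<phi> (extent j b)))"
          by (simp add: sum_product)
        also have "\<dots> \<le> 10 * ((2 * K) * (2 * K))"
        proof (intro mult_left_mono mult_mono)
          show "(\<Sum>a=1..m. \<phi> (extent i a)) \<le> 2 * K"
            using sum_extent_le[of \<phi>, OF \<phi>_nonneg x(2)] K(2)[of m] by linarith
          show "(\<Sum>b=1..n. \<phi> (extent j b)) \<le> 2 * K"
            using sum_extent_le[of \<phi>, OF \<phi>_nonneg x(3)] K(2)[of n] by linarith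
        qed (use K \<phi>_nonneg[OF extent_pos] in \<open>auto intro: sum_nonneg\<close>)
        finally show "(\<Sum>y\<in>P. 10 * \<phi> (card (G x y))) \<le> 40 * K\<^sup>2" by (simp add: power2_eq_square)
      qed
      also have "\<dots> = 40 * K\<^sup>2 * (real n * real m)" by (simp add: P_def positions_def)
      finally have "2 + (\<Sum>(x, y)\<in>T. 10 * (1 + log 2 (\<kappa> x y)) / \<kappa> x y) \<le> 2 * 1 + 40 * K\<^sup>2 * (real n * real m)" by simp
      also have "\<dots> \<le> 2 * (real n * real m) + 40 * K\<^sup>2 * (real n * real m)"
        using mult_mono[of 1 "real n" 1 "real m"] mn by simp
      finally show "2 + (\<Sum>(x, y)\<in>T. 10 * (1 + log 2 (\<kappa> x y)) / \<kappa> x y) \<le> (2 + 40 * K\<^sup>2) * (real n * real m)"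
        by (simp add: algebra_simps)
    qed
    finally show ?thesis .
  qed
  have "0 < 2 + 40 * K\<^sup>2" by (simp add: add_pos_nonneg)
  with bound show ?thesis by blast
qed

text \<open>Horizontally the costs sum to at most \<open>2 * K\<close> per column as before.
  Vertically a range starts at row 1, so its height is \<open>max i a\<close>, and about
  \<open>i\<close> pairs share height \<open>i\<close>; the sum of \<open>i * \<phi> i\<close> has
  the order of the squared logarithm, like the cost of the diagonal.\<close>

lemma three_sided_le:
  "\<exists>C>0. \<forall>m n. 2 \<le> m \<longrightarrow> m \<le> n \<longrightarrow>
    expected_effective_entropy m n (three_sided m n) \<le> ennreal (C * (real n * (log 2 (real m))\<^sup>2))"
proof -
  obtain K where K: "0 < K" "\<And>N. (\<Sum>t=1..N. \<phi> t) \<le> K" using sum_\<phi>_bounded by auto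
  \<comment> \<open>The smallest query range containing \<open>x\<close> and \<open>y\<close>, with the column of \<open>y\<close> cut below \<open>y\<close>:
    in that column only the topmost entry larger than \<open>x\<close> gets recorded.\<close>
  define G :: "nat \<times> nat \<Rightarrow> nat \<times> nat \<Rightarrow> (nat \<times> nat) set" where
    "G = (\<lambda>(i, j) (a, b). {1..max i a} \<times> ({min j b..max j b} - {b}) \<union> {1..a} \<times> {b})"
  \<comment> \<open>The area of the uncut range: unlike \<open>card (G x y)\<close> it is a product
    of height and width, and it is at most twice as large for the off-diagonal pairs
    considered.\<close>
  define s :: "nat \<times> nat \<Rightarrow> nat \<times> nat \<Rightarrow> nat" where "s = (\<lambda>(i, j) (a, b). max i a * extent j b)"
  \<comment> \<open>A diagonal event is a record among the \<open>fst x\<close> topmost entries of a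
    column, with probability \<open>1 / fst x\<close>; so there is no square.\<close>
  define \<kappa> where "\<kappa> x y = (if x = y then real (fst x) else (real (s x y))\<^sup>2)" for x y
  have cardG: "card (G (i, j) (a, b)) = max i a * (extent j b - 1) + a" for i j a b
  proof -
    have "card (G (i, j) (a, b)) = card ({1..max i a} \<times> ({min j b..max j b} - {b})) + card ({1..a} \<times> {b})"
      unfolding G_def prod.case by (rule card_Un_disjoint) auto
    also have "\<dots> = max i a * card ({min j b..max j b} - {b}) + a"
      by (simp add: card_cartesian_product)
    also have "card ({min j b..max j b} - {b}) = extent j b - 1"
      unfolding extent_def by (rule card_Diff_singleton) auto
    finally show ?thesis .
  qed
  have Gxx: "G (i, j) (i, j) = {1..i} \<times> {j}" for i j by (auto simp: G_def)
  \<comment> \<open>Here 62 is the additive 2 plus 10 * 6 from the diagonal, and 240 is 10 * 12 * 2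
    from the rows and columns of all pairs.\<close>
  have bound: "expected_effective_entropy m n (three_sided m n) \<le>
      ennreal ((62 + 240 * K) * (real n * (log 2 (real m))\<^sup>2))" if mn: "2 \<le> m" "m \<le> n" for m n
  proof -
    define P where "P = positions m n"
    define T where "T = {(x, y) \<in> P \<times> P. y = x \<or> y \<notin> G x x}"
    have s1: "1 \<le> s x y" if "x \<in> P" for x y
      using that extent_pos by (cases x; cases y) (auto simp: s_def P_def positions_def Suc_le_eq)
    have "expected_effective_entropy m n (three_sided m n) \<le>
      ennreal (2 + (\<Sum>(x, y)\<in>T. 10 * (1 + log 2 (\<kappa> x y)) / \<kappa> x y))"
      unfolding T_def P_def
    proof (rule expected_effective_entropy_le_hull[where G = G and \<kappa> = \<kappa>])
      fix x y assume T: "(x, y) \<in> {(x, y) \<in> positions m n \<times> positions m n. y = x \<or> y \<notin> G x x}"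
      obtain i j a b where xy: "x = (i, j)" "y = (a, b)" by (cases x; cases y)
      have ij: "1 \<le> i" "i \<le> m" "1 \<le> j" "j \<le> n" and ab: "1 \<le> a" "a \<le> m" "1 \<le> b" "b \<le> n"
        and out: "b = j \<Longrightarrow> i \<le> a"
        using T by (auto simp: xy positions_def Gxx)
      show sub: "G x y \<subseteq> positions m n \<and> x \<in> G x y \<and> y \<in> G x y"
        using ij ab out by (auto simp: xy G_def positions_def)
      show "1 \<le> \<kappa> x y" using ij s1[of x y] T by (auto simp: \<kappa>_def xy P_def)
      show "\<kappa> x y \<le> 8 * (real (card (G x y)) * (real (card (G x y)) - 1))" if "x \<noteq> y"
      proof -
        let ?M = "max i a" and ?w = "extent j b" and ?c = "card (G x y)"
        have c: "?c = ?M * (?w - 1) + a" by (simp add: xy cardG)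
        \<comment> \<open>Within one column \<open>y\<close> lies below \<open>x\<close> and the cut
          removes nothing; otherwise it affects only one of at least two columns.\<close>
        have "?M * ?w \<le> 2 * ?c"
        proof (cases "b = j")
          case True
          then show ?thesis using out by (simp add: c extent_def)
        next
          case False
          then have "2 \<le> ?w" by (auto simp: extent_def)
          then have "?M * ?w \<le> ?M * (2 * (?w - 1))" by (intro mult_left_mono) auto
          also have "\<dots> \<le> 2 * ?c" unfolding c distrib_left by (simp only: mult.left_commute le_add1)
          finally show ?thesis .
        qed
        then have "real (s x y) \<le> 2 * real ?c" unfolding s_def xy by (simp flip: of_nat_mult)
        then have "(real (s x y))\<^sup>2 \<le> (2 * real ?c)\<^sup>2" by (rule power_mono) simp
        moreover have "2 \<le> real ?c"
        proof -
          have "finite (G x y)" by (simp add: xy G_def)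
          then have "card {x, y} \<le> ?c" using sub by (intro card_mono) auto
          then show ?thesis using that by simp
        qed
        \<comment> \<open>Equivalent to \<open>(2 * c) * (2 * c) \<le> 8 * (c * (c - 1))\<close>,
          with equality at \<open>c = 2\<close>: this is the origin of the slack 8.\<close>
        then have "0 \<le> real ?c * (4 * real ?c - 8)" by simp
        ultimately show ?thesis using that by (simp add: \<kappa>_def power2_eq_square algebra_simps)
      qed
      show "G x y \<subseteq> q" if "q \<in> three_sided m n" "x \<in> q" "y \<in> q" for q
        using that by (auto simp: three_sided_def G_def xy)
      show "G x z \<subset> G x y"
        if Tz: "(x, z) \<in> {(x, y) \<in> positions m n \<times> positions m n. y = x \<or> y \<notin> G x x}" and z: "z \<in> G x y - {x, y}" for z
      proof -
        obtain c e where ce: "z = (c, e)" by (cases z)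
        have out': "e = j \<Longrightarrow> i < c" using Tz z by (auto simp: xy ce positions_def Gxx)
        \<comment> \<open>In the column of \<open>y\<close>, \<open>z\<close> lies above
          \<open>y\<close> and shortens the cut column; in any other column, the range of
          \<open>x\<close> and \<open>z\<close> does not reach the column of
          \<open>y\<close>.\<close>
        have "G x z \<subseteq> G x y \<and> y \<notin> G x z"
        proof (cases "e = b")
          case True
          then have "c < a" using z by (auto simp: xy ce G_def)
          then show ?thesis using True out' by (auto simp: xy ce G_def)
        next
          case False
          then have "c \<le> max i a" "e \<in> {min j b..max j b} - {b}" using z by (auto simp: xy ce G_def)
          then show ?thesis by (auto simp: xy ce G_def)
        qed
        then show ?thesis using sub by blast
      qed
    next
      fix x assume "x \<in> positions m n"
      then show "\<kappa> x x \<le> 8 * real (card (G x x))"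
        by (cases x) (simp add: \<kappa>_def Gxx card_cartesian_product)
    next
      fix q assume "q \<in> three_sided m n"
      then show "q \<subseteq> positions m n \<and> q \<noteq> {}" by (auto simp: three_sided_def positions_def)
    qed
    also have "\<dots> \<le> ennreal ((62 + 240 * K) * (real n * (log 2 (real m))\<^sup>2))"
    proof (rule ennreal_leI)
      define L where "L = (log 2 (real m))\<^sup>2"
      have L1: "1 \<le> L" unfolding L_def using log2_ge_1[OF mn(1)] by (simp add: one_le_power)
      \<comment> \<open>The numerator has twice the logarithm that is needed, to match
        \<open>sum_log_div_le\<close>.\<close>
      define D where "D x = 10 * ((1 + 2 * log 2 (real (fst x))) / fst x)" for x :: "nat \<times> nat"
      have cost: "10 * (1 + log 2 (\<kappa> x y)) / \<kappa> x y \<le> (if x = y then D x else 0) + 10 * \<phi> (s x y)"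
        if "x \<in> P" for x y
      proof (cases "x = y")
        case True
        have f: "1 \<le> fst x" using that by (auto simp: P_def positions_def)
        have "10 * (1 + log 2 (real (fst x))) / fst x \<le> 10 * (1 + 2 * log 2 (real (fst x))) / fst x"
          using f by (intro divide_right_mono) auto
        then have "10 * (1 + log 2 (\<kappa> x y)) / \<kappa> x y \<le> D x" using True by (simp add: \<kappa>_def D_def)
        moreover have "(if x = y then D x else 0) = D x" using True by simp
        ultimately show ?thesis using \<phi>_nonneg[OF s1[OF that, of y]] by linarith
      next
        case False
        then show ?thesis using s1[OF that, of y] by (simp add: \<kappa>_def \<phi>_def log_nat_power)
      qed
      have D0: "0 \<le> D x" if "x \<in> P" for x using that by (auto simp: D_def P_def positions_def)
      have "(\<Sum>(x, y)\<in>T. 10 * (1 + log 2 (\<kappa> x y)) / \<kappa> x y) \<le>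
          (\<Sum>(x, y)\<in>T. (if x = y then D x else 0) + 10 * \<phi> (s x y))"
        by (rule sum_mono) (use cost in \<open>auto simp: T_def\<close>)
      also have "\<dots> \<le> (\<Sum>(x, y)\<in>P \<times> P. (if x = y then D x else 0) + 10 * \<phi> (s x y))"
        by (rule sum_mono2) (use \<phi>_nonneg[OF s1] D0 in \<open>auto simp: P_def T_def\<close>)
      also have "\<dots> = (\<Sum>x\<in>P. \<Sum>y\<in>P. if x = y then D x else 0) + (\<Sum>x\<in>P. \<Sum>y\<in>P. 10 * \<phi> (s x y))"
        by (simp add: sum.cartesian_product[symmetric] sum.distrib)
      also have "(\<Sum>x\<in>P. \<Sum>y\<in>P. if x = y then D x else 0) = (\<Sum>x\<in>P. D x)"
        by (rule sum.cong) (auto simp: P_def)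
      also have "(\<Sum>x\<in>P. D x) \<le> 60 * (n * L)"
      proof -
        have "(\<Sum>x\<in>P. D x) = (\<Sum>i=1..m. \<Sum>j=1..n. 10 * ((1 + 2 * log 2 (real i)) / i))"
          unfolding P_def sum_positions D_def by simp
        also have "\<dots> = 10 * n * (\<Sum>i=1..m. (1 + 2 * log 2 (real i)) / i)"
          by (simp add: sum_distrib_left mult_ac)
        also have "\<dots> \<le> 10 * n * (6 * L)"
          unfolding L_def by (rule mult_left_mono[OF sum_log_div_le[OF mn(1)]]) simp
        finally show ?thesis by (simp add: mult_ac)
      qed
      also have "(\<Sum>x\<in>P. \<Sum>y\<in>P. 10 * \<phi> (s x y)) \<le> 240 * K * (n * L)"
      proof -
        have "(\<Sum>x\<in>P. \<Sum>y\<in>P. 10 * \<phi> (s x y)) \<le> (\<Sum>x\<in>P. \<Sum>y\<in>P. 10 * (\<phi> (max (fst x) (fst y)) * \<phi> (extent (snd x) (snd y))))"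
        proof (intro sum_mono mult_left_mono)
          fix x y assume "x \<in> P" "y \<in> P"
          then have "1 \<le> max (fst x) (fst y)" by (auto simp: P_def positions_def)
          from \<phi>_mult_le[OF this extent_pos, of "snd x" "snd y"]
          show "\<phi> (s x y) \<le> \<phi> (max (fst x) (fst y)) * \<phi> (extent (snd x) (snd y))"
            by (simp add: s_def case_prod_unfold)
        qed simp
        also have "\<dots> = (\<Sum>i=1..m. \<Sum>j=1..n. \<Sum>a=1..m. \<Sum>b=1..n. 10 * (\<phi> (max i a) * \<phi> (extent j b)))"
          unfolding P_def sum_positions by simp
        also have "\<dots> = 10 * (\<Sum>i=1..m. \<Sum>a=1..m. \<phi> (max i a)) * (\<Sum>j=1..n. \<Sum>b=1..n. \<phi> (extent j b))"
        proof -
          have "(\<Sum>a\<in>X. \<Sum>b\<in>Y. c * (f a * h b)) = c * ((\<Sum>a\<in>X. f a) * (\<Sum>b\<in>Y. h b))"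
            for X Y :: "nat set" and c :: real and f h
            by (subst sum_product) (simp only: sum_distrib_left)
          then show ?thesis by (simp only: mult.assoc)
        qed
        also have "\<dots> \<le> 10 * (12 * L) * (n * (2 * K))"
        proof (intro mult_mono mult_left_mono)
          \<comment> \<open>Split by which row is the lower one. By symmetry both halves are equal,
            and in each the value \<open>\<phi> i\<close> occurs \<open>i\<close> times.\<close>
          have "(\<Sum>i=1..m. \<Sum>a=1..m. \<phi> (max i a)) \<le>
              (\<Sum>i=1..m. \<Sum>a=1..m. (if a \<le> i then \<phi> i else 0) + (if i \<le> a then \<phi> a else 0))"
            by (intro sum_mono) (auto simp: max_def \<phi>_nonneg)
          also have "\<dots> = (\<Sum>i=1..m. \<Sum>a=1..m. if a \<le> i then \<phi> i else 0) + (\<Sum>a=1..m. \<Sum>i=1..m. if i \<le> a then \<phi> a else 0)"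
            by (subst sum.swap[of _ "{1..m}" "{1..m}"]) (simp add: sum.distrib sum.swap[of "\<lambda>i a. if i \<le> a then \<phi> a else 0"])
          also have "\<dots> = 2 * (\<Sum>i=1..m. \<Sum>a=1..m. if a \<le> i then \<phi> i else 0)" by simp
          also have "(\<Sum>i=1..m. \<Sum>a=1..m. if a \<le> i then \<phi> i else 0) = (\<Sum>i=1..m. (1 + 2 * log 2 (real i)) / i)"
          proof (rule sum.cong[OF refl])
            fix i assume i: "i \<in> {1..m}"
            have "(\<Sum>a=1..m. if a \<le> i then \<phi> i else 0) = (\<Sum>a=1..i. \<phi> i)"
              by (rule sum.mono_neutral_cong_right) (use i in auto)
            also have "\<dots> = (1 + 2 * log 2 (real i)) / i"
              using i by (simp add: \<phi>_def power2_eq_square)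
            finally show "(\<Sum>a=1..m. if a \<le> i then \<phi> i else 0) = (1 + 2 * log 2 (real i)) / i" .
          qed
          also have "2 * (\<Sum>i=1..m. (1 + 2 * log 2 (real i)) / i) \<le> 12 * L"
            using sum_log_div_le[OF mn(1)] by (simp add: L_def)
          finally show "(\<Sum>i=1..m. \<Sum>a=1..m. \<phi> (max i a)) \<le> 12 * L" by simp
          have "(\<Sum>b=1..n. \<phi> (extent j b)) \<le> 2 * K" if "j \<in> {1..n}" for j
            using sum_extent_le[of \<phi>, OF \<phi>_nonneg that] K(2)[of n] by linarith
          then have "(\<Sum>j=1..n. \<Sum>b=1..n. \<phi> (extent j b)) \<le> (\<Sum>j=1..n. 2 * K)" by (rule sum_mono)
          then show "(\<Sum>j=1..n. \<Sum>b=1..n. \<phi> (extent j b)) \<le> n * (2 * K)" by simp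
        qed (use L1 in \<open>auto intro!: sum_nonneg \<phi>_nonneg extent_pos simp: le_max_iff_disj\<close>)
        finally show ?thesis by (simp add: mult_ac)
      qed
      finally have "2 + (\<Sum>(x, y)\<in>T. 10 * (1 + log 2 (\<kappa> x y)) / \<kappa> x y) \<le> 2 * 1 + 60 * (n * L) + 240 * K * (n * L)"
        by simp
      also have "\<dots> \<le> 2 * (n * L) + 60 * (n * L) + 240 * K * (n * L)"
      proof -
        have "1 * 1 \<le> real n * L" by (rule mult_mono) (use mn L1 in auto)
        then show ?thesis by (simp add: mult.commute)
      qed
      finally show "2 + (\<Sum>(x, y)\<in>T. 10 * (1 + log 2 (\<kappa> x y)) / \<kappa> x y) \<le> (62 + 240 * K) * (real n * (log 2 (real m))\<^sup>2)"
        by (simp add: algebra_simps L_def)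
    qed
    finally show ?thesis .
  qed
  have "0 < 62 + 240 * K" using K(1) by simp
  with bound show ?thesis by blast
qed

section \<open>Lower bounds for the two query sets, and the theorem\<close>

lemma four_sidedI:
  "1 \<le> i1 \<Longrightarrow> i1 \<le> i2 \<Longrightarrow> i2 \<le> m \<Longrightarrow> 1 \<le> j1 \<Longrightarrow> j1 \<le> j2 \<Longrightarrow> j2 \<le> n \<Longrightarrow>
    {i1..i2} \<times> {j1..j2} \<in> four_sided m n"
  unfolding four_sided_def by blast

text \<open>The entries in even columns have one predecessor each and contribute
  \<open>log 2 2 / 2\<close>, that is 1/2; they make up at least a third of every row.\<close>

lemma four_sided_ge:
  assumes "2 \<le> m" "m \<le> n"
  shows "ennreal (1/6 * (real n * real m)) \<le> expected_effective_entropy m n (four_sided m n)"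
proof -
  define P where "P = positions m n"
  \<comment> \<open>Columns are counted from 1, so \<open>(j + 1) div 2\<close> joins columns
    \<open>2 * t - 1\<close> and \<open>2 * t\<close>; if \<open>n\<close> is odd, the last column
    is a chain by itself.\<close>
  define g :: "nat \<times> nat \<Rightarrow> nat \<times> nat" where "g = (\<lambda>(i, j). (i, (j + 1) div 2))"
  define k where "k p = real (card (preds g snd P p) + 1)" for p
  have preds: "preds g snd P (i, j) = (if even j then {(i, j - 1)} else {})" if "(i, j) \<in> P" for i j
  proof -
    have "(b + 1) div 2 = (j + 1) div 2 \<and> b < j \<longleftrightarrow> even j \<and> b = j - 1" if "1 \<le> b" "1 \<le> j" for b
      using that by presburger
    moreover have "even j \<Longrightarrow> 1 \<le> j - 1" if "1 \<le> j" using that by presburger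
    ultimately show ?thesis using that by (auto simp: preds_def g_def P_def positions_def)
  qed
  have k: "k (i, j) = (if even j then 2 else 1)" if "(i, j) \<in> P" for i j
    by (simp add: k_def preds[OF that])
  \<comment> \<open>The worst case is \<open>n = 3\<close>, with one even column out of
    three.\<close>
  have half: "real n / 3 \<le> (\<Sum>j=1..n. if even j then 1 else 0)"
  proof -
    have "(\<Sum>j=1..n. if even j then 1 else (0::real)) = real (n div 2)"
      by (induction n) (auto elim!: oddE)
    moreover have "n \<le> 3 * (n div 2)" using assms by presburger
    ultimately show ?thesis by simp
  qed
  have "1/6 * (real n * real m) \<le> (\<Sum>i=1..m. real n / 3 * (1/2))" by simp
  also have "\<dots> \<le> (\<Sum>i=1..m. (\<Sum>j=1..n. if even j then 1 else 0) * (1/2))"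
    by (intro sum_mono mult_right_mono half) simp
  also have "\<dots> = (\<Sum>i=1..m. \<Sum>j=1..n. log 2 (k (i, j)) / k (i, j))"
    unfolding sum_distrib_right
    by (intro sum.cong refl) (auto simp: k P_def positions_def)
  also have "\<dots> = (\<Sum>p\<in>P. log 2 (k p) / k p)"
    by (simp only: P_def sum_positions)
  finally have "ennreal (1/6 * (real n * real m)) \<le> ennreal (\<Sum>p\<in>P. log 2 (k p) / k p)" by (rule ennreal_leI)
  also have "\<dots> \<le> expected_effective_entropy m n (four_sided m n)"
    unfolding k_def P_def
  proof (rule expected_effective_entropy_ge)
    fix p assume p: "p \<in> positions m n"
    obtain i j where ij: "p = (i, j)" by (cases p)
    have "insert p (preds g snd (positions m n) p) = {i..i} \<times> {(if even j then j - 1 else j)..j}"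
      using preds[of i j] p by (auto simp: ij P_def)
    moreover have "{i..i} \<times> {(if even j then j - 1 else j)..j} \<in> four_sided m n"
    proof (rule four_sidedI)
      have "1 \<le> j" using p by (simp add: ij positions_def)
      then show "1 \<le> (if even j then j - 1 else j)" by (cases "even j") (auto elim!: evenE)
    qed (use p in \<open>auto simp: ij positions_def\<close>)
    ultimately show "insert p (preds g snd (positions m n) p) \<in> four_sided m n" by simp
  qed (auto simp: g_def)
  finally show ?thesis .
qed

lemma three_sidedI:
  "1 \<le> i \<Longrightarrow> i \<le> m \<Longrightarrow> 1 \<le> j1 \<Longrightarrow> j1 \<le> j2 \<Longrightarrow> j2 \<le> n \<Longrightarrow> {1..i} \<times> {j1..j2} \<in> three_sided m n"
  unfolding three_sided_def by blast

lemma three_sided_ge: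
  assumes "2 \<le> m" "m \<le> n"
  shows "ennreal (1/6 * (real n * (log 2 (real m))\<^sup>2)) \<le> expected_effective_entropy m n (three_sided m n)"
proof -
  define P where "P = positions m n"
  define k where "k p = real (card (preds snd fst P p) + 1)" for p
  have preds: "preds snd fst P (i, j) = {1..<i} \<times> {j}" if "(i, j) \<in> P" for i j
    using that by (auto simp: preds_def P_def positions_def)
  have k: "k (i, j) = i" if "(i, j) \<in> P" for i j
    unfolding k_def preds[OF that] using that by (simp add: card_cartesian_product P_def positions_def)
  have "1/6 * (real n * (log 2 (real m))\<^sup>2) = (\<Sum>j=1..n. (log 2 (real m))\<^sup>2 / 6)" by simp
  also have "\<dots> \<le> (\<Sum>j=1..n. \<Sum>i=1..m. log 2 (real i) / i)"
    by (rule sum_mono) (rule sum_log_div_ge, use assms in simp)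
  also have "\<dots> = (\<Sum>i=1..m. \<Sum>j=1..n. log 2 (k (i, j)) / k (i, j))"
    by (subst sum.swap) (intro sum.cong refl, simp add: k P_def positions_def)
  also have "\<dots> = (\<Sum>p\<in>P. log 2 (k p) / k p)"
    by (simp only: P_def sum_positions)
  finally have "ennreal (1/6 * (real n * (log 2 (real m))\<^sup>2)) \<le> ennreal (\<Sum>p\<in>P. log 2 (k p) / k p)" by (rule ennreal_leI)
  also have "\<dots> \<le> expected_effective_entropy m n (three_sided m n)"
    unfolding k_def P_def
  proof (rule expected_effective_entropy_ge)
    fix p assume p: "p \<in> positions m n"
    obtain i j where ij: "p = (i, j)" by (cases p)
    have "insert p (preds snd fst (positions m n) p) = {1..i} \<times> {j..j}"
      using preds[of i j] p by (auto simp: ij P_def positions_def)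
    moreover have "{1..i} \<times> {j..j} \<in> three_sided m n"
      by (rule three_sidedI) (use p in \<open>auto simp: ij positions_def\<close>)
    ultimately show "insert p (preds snd fst (positions m n) p) \<in> three_sided m n" by simp
  qed auto
  finally show ?thesis .
qed

theorem theorem5:
  shows "(\<exists>c C :: real. 0 < c \<and> 0 < C \<and>
           (\<forall>m n :: nat. 2 \<le> m \<and> m \<le> n \<longrightarrow>
              ennreal (c * (real n * real m)) \<le> expected_effective_entropy m n (four_sided m n) \<and>
              expected_effective_entropy m n (four_sided m n) \<le> ennreal (C * (real n * real m))))
       \<and> (\<exists>c C :: real. 0 < c \<and> 0 < C \<and>
           (\<forall>m n :: nat. 2 \<le> m \<and> m \<le> n \<longrightarrow>
              ennreal (c * (real n * (log 2 (real m))\<^sup>2))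
                \<le> expected_effective_entropy m n (three_sided m n) \<and>
              expected_effective_entropy m n (three_sided m n)
                \<le> ennreal (C * (real n * (log 2 (real m))\<^sup>2))))"
proof (intro conjI)
  obtain C where C: "0 < C" "\<And>m n. 2 \<le> m \<Longrightarrow> m \<le> n \<Longrightarrow>
      expected_effective_entropy m n (four_sided m n) \<le> ennreal (C * (real n * real m))"
    using four_sided_le by blast
  show "\<exists>c C :: real. 0 < c \<and> 0 < C \<and>
      (\<forall>m n :: nat. 2 \<le> m \<and> m \<le> n \<longrightarrow>
        ennreal (c * (real n * real m)) \<le> expected_effective_entropy m n (four_sided m n) \<and>
        expected_effective_entropy m n (four_sided m n) \<le> ennreal (C * (real n * real m)))"
    by (rule exI[of _ "1/6"], rule exI[of _ C]) (use C four_sided_ge in auto)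
next
  obtain C where C: "0 < C" "\<And>m n. 2 \<le> m \<Longrightarrow> m \<le> n \<Longrightarrow>
      expected_effective_entropy m n (three_sided m n) \<le> ennreal (C * (real n * (log 2 (real m))\<^sup>2))"
    using three_sided_le by blast
  show "\<exists>c C :: real. 0 < c \<and> 0 < C \<and>
      (\<forall>m n :: nat. 2 \<le> m \<and> m \<le> n \<longrightarrow>
        ennreal (c * (real n * (log 2 (real m))\<^sup>2)) \<le> expected_effective_entropy m n (three_sided m n) \<and>
        expected_effective_entropy m n (three_sided m n) \<le> ennreal (C * (real n * (log 2 (real m))\<^sup>2)))"
    by (rule exI[of _ "1/6"], rule exI[of _ C]) (use C three_sided_ge in auto)
qed

end
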